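(* Let $m,n,s,k$ be positive integers with $m+s=n+k$, and let $\mathbf{a}=(a_1,\ldots,a_s)$, $\mathbf{b}=(b_1,\ldots,b_k)$, $\mathbf{c}=(c_1,\ldots,c_n)$, $\mathbf{d}=(d_1,\ldots,d_m)$ be partitions (nonincreasing sequences of integers) such that $c_i\neq d_j$ for all $i,j$. With $S,\Delta,h,h',c^y,d^x,m_y,t_y,z_y,m'_x,t'_x,z'_x,\mathbf{e},\mathbf{e}'$ as in the context, there exists a partition $\mathbf{g}=(g_1,\ldots,g_{m+s})$ such that $\mathbf{g}\prec'(\mathbf{d},\mathbf{a})$ and $\mathbf{g}\prec'(\mathbf{c},\mathbf{b})$ if and only if $$\sum_{i=1}^n c_i+\sum_{i=1}^k b_i=\sum_{i=1}^m d_i+\sum_{i=1}^s a_i$$ and the following two conditions hold: (i) for every $y\in\{1,\ldots,h'\}$ with $t_y\le m_y$, $\displaystyle\sum_{i=z_y+t_y}^{z_y+m_y}e_i\le \sum_{i=y}^{h'} c^i-\sum_{i\ge z_y+1,\ i\notin \Delta }d_i-\sum_{i=m_y+1}^s a_i$; (ii) for every $x\in\{1,\ldots,h\}$ with $t'_x\le m'_x$, $\displaystyle\sum_{i=z'_x+t'_x}^{z'_x+m'_x}e'_i\le \sum_{i=x}^{h} d^i-\sum_{i\ge z'_x+1,\ i\notin S }c_i-\sum_{i=m'_x+1}^k b_i$.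
   Context: Conventions: for any finite sequence $y_1,\ldots,y_w$, $\sum_{i=r}^{s}y_i=0$ if $r>s$, $y_i=+\infty$ for $i\le 0$ and $y_i=-\infty$ for $i>w$. Generalized majorization: for partitions $\mathbf{d}=(d_1,\ldots,d_m)$, $\mathbf{a}=(a_1,\ldots,a_s)$, $\mathbf{g}=(g_1,\ldots,g_{m+s})$, put $h_j:=\min\{i\mid d_{i-j+1}<g_i\}$, $j=1,\ldots,s$. We write $\mathbf{g}\prec'(\mathbf{d},\mathbf{a})$ if (1) $d_i\ge g_{i+s}$ for $i=1,\ldots,m$; (2) $\sum_{i=1}^{h_j}g_i-\sum_{i=1}^{h_j-j}d_i\le\sum_{i=1}^j a_i$ for $j=1,\ldots,s$; (3) $\sum_{i=1}^{m+s}g_i=\sum_{i=1}^m d_i+\sum_{i=1}^s a_i$. The relation $\mathbf{g}\prec'(\mathbf{c},\mathbf{b})$ is defined the same way with $(\mathbf{c},\mathbf{b},n,k)$ in place of $(\mathbf{d},\mathbf{a},m,s)$. Unions: $\mathbf{e}=(e_1,\ldots,e_{m+s})$ is the nonincreasing rearrangement of $d_1,\ldots,d_m,a_1,\ldots,a_s$, where equal $a$'s are placed before equal $d$'s. Similarly $\mathbf{e}'=(e'_1,\ldots,e'_{n+k})$ is the nonincreasing rearrangement of $c_1,\ldots,c_n,b_1,\ldots,b_k$ with equal $b$'s placed before equal $c$'s. Sets $S\subseteq\{1,\ldots,n\}$, $\Delta\subseteq\{1,\ldots,m\}$ are defined inductively. Start with both empty and process the elements of $\{c_1,\ldots,c_n\}\cup\{d_1,\ldots,d_m\}$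 one at a time from smallest to largest; among equal $c$'s (resp. equal $d$'s) the one with largest index is processed first. At each step "$i\notin\Delta$" (resp. "$i\notin S$") refers to already processed indices not placed in $\Delta$ (resp. $S$), and $S,\Delta$ denote their current contents. If the processed element is $d_j$: set $q_j:=s-\#\{i\in S\mid c_i<d_j\}+\#\{i>j\mid i\notin\Delta\}+1$. If $q_j>s$, put $j\in\Delta$. If $q_j\le s$, let $l\in S$ be the minimal index with $d_j>c_l$ and $N:=\#\{i\mid a_i>c_l\}-s+\#\{i\in S\mid i>l\}-\#\{i\notin\Delta\mid d_i<c_l\}+1$. (a) If $N\ge1$ and $d_j$ is among the $N$ smallest entries of $\mathbf{e}$ bigger than $c_l$, put $j\notin\Delta$. (b) Otherwise put $j\notin\Delta$ if $\sum_{c_i<d_j,\,i\in S}c_i\ge\sum_{i\notin\Delta,\,i>j}d_i+d_j+\sum_{i=q_j+1}^s a_i$, and $j\in\Delta$ if it fails. If the processed element is $c_j$: dually set $q'_j:=k-\#\{i\in\Delta\mid d_i<c_j\}+\#\{i>j\mid i\notin S\}+1$. If $q'_j>k$, put $j\in S$. If $q'_j\le k$, let $l\in\Delta$ be the minimal index with $c_j>d_l$ and $N':=\#\{i\mid b_i>d_l\}-k+\#\{i\in\Delta\mid i>l\}-\#\{i\notin S\mid c_i<d_l\}+1$. (a) If $N'\ge1$ and $c_j$ is among the $N'$ smallest entries of $\mathbf{e}'$ bigger than $d_l$, put $j\notin S$. (b) Otherwise put $j\notin S$ if $\sum_{d_i<c_j,\,i\in\Delta}d_i\ge\sum_{i\notin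 S,\,i>j}c_i+c_j+\sum_{i=q'_j+1}^k b_i$, and $j\in S$ if it fails. After the construction: $h=\#\Delta$, $h'=\#S$; $d^1\ge\cdots\ge d^h$ are the $d_i$ with $i\in\Delta$ and $c^1\ge\cdots\ge c^{h'}$ the $c_i$ with $i\in S$. For $j=1,\ldots,h'$: $m_j:=\#\{i\mid a_i>c^j\}$, $t_j:=s-(h'-j)+\#\{i\notin\Delta\mid d_i<c^j\}$, $z_j:=\#\{i\mid d_i>c^j\}$. For $j=1,\ldots,h$: $m'_j:=\#\{i\mid b_i>d^j\}$, $t'_j:=k-(h-j)+\#\{i\notin S\mid c_i<d^j\}$, $z'_j:=\#\{i\mid c_i>d^j\}$. Here $i\notin\Delta$ means $i\in\{1,\ldots,m\}\setminus\Delta$ and $i\notin S$ means $i\in\{1,\ldots,n\}\setminus S$. *)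

theory Defs
  imports Main "HOL-Library.Extended_Real" "HOL-Library.Product_Lexorder"
begin

text \<open>Sequences are int lists, indexed from 1: entry i of xs is xs!(i-1).\<close>

definition is_partition :: "int list \<Rightarrow> bool" where
  "is_partition xs \<longleftrightarrow> sorted_wrt (\<lambda>x y. x \<ge> y) xs"

definition E :: "int list \<Rightarrow> int \<Rightarrow> ereal" where
  "E xs i = (if i \<le> 0 then \<infinity> else if i > int (length xs) then -\<infinity>
             else ereal (xs ! (nat i - 1)))"

definition sumE :: "int list \<Rightarrow> int \<Rightarrow> int \<Rightarrow> ereal" where
  "sumE xs r t = (\<Sum>i\<in>{r..t}. E xs i)"

definition hj :: "int list \<Rightarrow> int list \<Rightarrow> nat \<Rightarrow> nat" where
  "hj d g j = (LEAST i. i \<ge> 1 \<and> E d (int i - int j + 1) < E g (int i))"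

definition gmaj :: "int list \<Rightarrow> int list \<Rightarrow> int list \<Rightarrow> bool" where
  "gmaj g d a \<longleftrightarrow>
     (\<forall>i\<in>{1..length d}. d ! (i - 1) \<ge> g ! (i + length a - 1)) \<and>
     (\<forall>j\<in>{1..length a}.
        sumE g 1 (int (hj d g j)) - sumE d 1 (int (hj d g j) - int j) \<le> sumE a 1 (int j)) \<and>
     sum_list g = sum_list d + sum_list a"

text \<open>Union e of d and a: nonincreasing rearrangement, equal a's placed before equal d's.
  Entries are tagged (value, 0 = a / 1 = d, index).\<close>
definition tunion :: "int list \<Rightarrow> int list \<Rightarrow> (int \<times> nat \<times> nat) list" where
  "tunion d a = sort_key (\<lambda>(v, t, i). (- v, t, i))
     (map (\<lambda>i. (a ! (i - 1), 0::nat, i)) [1..<Suc (length a)] @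
      map (\<lambda>i. (d ! (i - 1), 1::nat, i)) [1..<Suc (length d)])"

definition useq :: "int list \<Rightarrow> int list \<Rightarrow> int list" where
  "useq d a = map fst (tunion d a)"

definition among_smallest :: "int list \<Rightarrow> int list \<Rightarrow> nat \<Rightarrow> int \<Rightarrow> int \<Rightarrow> bool" where
  "among_smallest d a j N x \<longleftrightarrow>
     (let U = tunion d a;
          P = length (filter (\<lambda>u. fst u > x) U);
          pos = Suc (length (takeWhile (\<lambda>u. u \<noteq> (d ! (j - 1), 1, j)) U))
      in d ! (j - 1) > x \<and> pos \<le> P \<and> int pos > int P - N)"

text \<open>Decision when processing d_j (with data a, c, current S and processed indices not in Delta):
  True means "j is not put into Delta". The dual step for c_j is obtained by swapping roles.\<close>
definition proc :: "int list \<Rightarrow> int list \<Rightarrow> int list \<Rightarrow> nat set \<Rightarrow> nat set \<Rightarrow> nat \<Rightarrow> bool" where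
  "proc a c d S Dn j \<longleftrightarrow>
     (let s = length a; dj = d ! (j - 1);
          q = int s - int (card {i\<in>S. c ! (i - 1) < dj}) + int (card {i\<in>Dn. i > j}) + 1
      in if q > int s then False
         else
           (let l = (LEAST l. l \<in> S \<and> dj > c ! (l - 1)); cl = c ! (l - 1);
                N = int (card {i\<in>{1..s}. a ! (i - 1) > cl}) - int s
                    + int (card {i\<in>S. i > l}) - int (card {i\<in>Dn. d ! (i - 1) < cl}) + 1
            in if N \<ge> 1 \<and> among_smallest d a j N cl then True
               else ereal (\<Sum>i\<in>{i\<in>S. c ! (i - 1) < dj}. c ! (i - 1))
                      \<ge> ereal (\<Sum>i\<in>{i\<in>Dn. i > j}. d ! (i - 1)) + ereal dj
                        + sumE a (q + 1) (int s)))"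

text \<open>State: (S, processed c-indices not in S, Delta, processed d-indices not in Delta).
  Inl j stands for c_j, Inr j for d_j.\<close>
type_synonym cstate = "nat set \<times> nat set \<times> nat set \<times> nat set"

fun step :: "int list \<Rightarrow> int list \<Rightarrow> int list \<Rightarrow> int list \<Rightarrow> nat + nat \<Rightarrow> cstate \<Rightarrow> cstate" where
  "step a b c d (Inl j) (S, Sn, D, Dn) =
     (if proc b d c D Sn j then (S, insert j Sn, D, Dn) else (insert j S, Sn, D, Dn))"
| "step a b c d (Inr j) (S, Sn, D, Dn) =
     (if proc a c d S Dn j then (S, Sn, D, insert j Dn) else (S, Sn, insert j D, Dn))"

definition proc_order :: "int list \<Rightarrow> int list \<Rightarrow> (nat + nat) list" where
  "proc_order c d = sort_key
     (\<lambda>x. case x of Inl j \<Rightarrow> (c ! (j - 1), - int j) | Inr j \<Rightarrow> (d ! (j - 1), - int j))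
     (map Inl [1..<Suc (length c)] @ map Inr [1..<Suc (length d)])"

definition construct :: "int list \<Rightarrow> int list \<Rightarrow> int list \<Rightarrow> int list \<Rightarrow> cstate" where
  "construct a b c d = fold (step a b c d) (proc_order c d) ({}, {}, {}, {})"

definition Sset :: "int list \<Rightarrow> int list \<Rightarrow> int list \<Rightarrow> int list \<Rightarrow> nat set" where
  "Sset a b c d = fst (construct a b c d)"

definition Delta :: "int list \<Rightarrow> int list \<Rightarrow> int list \<Rightarrow> int list \<Rightarrow> nat set" where
  "Delta a b c d = fst (snd (snd (construct a b c d)))"

text \<open>Condition (i) (with data a, c, d, S, Delta); condition (ii) is cond_i b d c Delta S.\<close>
definition cond_i :: "int list \<Rightarrow> int list \<Rightarrow> int list \<Rightarrow> nat set \<Rightarrow> nat set \<Rightarrow> bool" where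
  "cond_i a c d S D \<longleftrightarrow>
     (let s = length a; m = length d; h' = card S;
          cS = rev (sort (map (\<lambda>i. c ! (i - 1)) (sorted_list_of_set S)));
          e = useq d a
      in \<forall>y\<in>{1..h'}.
           (let cy = cS ! (y - 1);
                my = int (card {i\<in>{1..s}. a ! (i - 1) > cy});
                ty = int s - (int h' - int y) + int (card {i\<in>{1..m} - D. d ! (i - 1) < cy});
                zy = int (card {i\<in>{1..m}. d ! (i - 1) > cy})
            in ty \<le> my \<longrightarrow>
               sumE e (zy + ty) (zy + my)
                 \<le> sumE cS (int y) (int h')
                    - ereal (\<Sum>i\<in>{i\<in>{1..m} - D. int i \<ge> zy + 1}. d ! (i - 1))
                    - sumE a (my + 1) (int s)))"

end

theory Submission
  imports Defs "HOL-Library.Multiset"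
begin

text \<open>Encode a finite sequence \<open>x\<close> by its counting function \<open>cnt x u = #{i. x\<^sub>i \<le> u}\<close> and the summed
  function \<open>ar x u = \<Sum>\<^sub>i max 0 (u - x\<^sub>i)\<close>. Then \<open>g \<prec>' (d, a)\<close> says that \<open>w = cnt g - cnt d\<close> is nonnegative and that,
  whenever \<open>w\<close> rises above a level \<open>i\<close> for good, \<open>ar g - ar d\<close> lies below the tangent of slope \<open>i\<close> of
  the convex function \<open>ar a\<close>. Let \<open>X\<close> consist of the \<open>c\<close>'s in \<open>S\<close> and the \<open>d\<close>'s in \<open>\<Delta>\<close>. The construction lets
  \<open>w\<close> descend at \<open>d\<^sub>j\<close> whenever the tangent condition permits it or \<open>w\<close> exceeds the current slope of \<open>ar a\<close>;
  therefore \<open>cnt X \<le> cnt g\<close> for every feasible \<open>g\<close>. Conditions (i) and (ii) state that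
  \<open>ar X \<le> ar d + ar a\<close> and \<open>ar X \<le> ar c + ar b\<close>, so they are necessary. Conversely, if they hold,
  keep \<open>X\<close> below a threshold \<open>T\<close> and put all other entries of \<open>g\<close> at \<open>T\<close> or \<open>T + 1\<close>, with \<open>T\<close> fixed by the total sum.\<close>

section \<open>Counting functions of integer sequences\<close>

text \<open>Beyond domination and the total sum, \<open>gmaj\<close> only bounds areas of
  \<open>g\<close> from above, and areas are monotone in counts, so a pointwise smallest count is
  the best candidate. One multiset serves both sides because no \<open>c\<close> equals a
  \<open>d\<close>: at each value only one of the two rules decides, and it sees only what lies
  below. Two obstacles shape the rest. \<open>X\<close> need not have the right length or sum, so it
  can prescribe \<open>g\<close> only below a threshold. And the tangent condition tests only the
  last ascent through a level, so earlier descents may violate the bound; rule (a) admits exactly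
  those violations that the area inequality repairs later. The same rule keeps \<open>X\<close>
  constant on the stretches above a selected \<open>c\<close> where its area could overtake that of
  \<open>e\<close>, which is why finitely many inequalities, one per selected entry, control
  \<open>ar X\<close> everywhere. They involve slices of \<open>e\<close> because such a slice sum
  is a Legendre transform of \<open>ar e\<close>: the condition at \<open>x\<close> says in essence
  that the line continuing \<open>ar X\<close> to the right of \<open>x\<close> stays below
  \<open>ar e\<close>.\<close>

definition cnt :: "int list \<Rightarrow> int \<Rightarrow> int" where
  "cnt xs u = int (length (filter (\<lambda>x. x \<le> u) xs))"

definition ar :: "int list \<Rightarrow> int \<Rightarrow> int" where
  "ar xs u = (\<Sum>x\<leftarrow>xs. max 0 (u - x))"

text \<open>For nonincreasing \<open>a\<close> these are the tangent lines of the convex function \<open>ar a\<close>: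
  the line of slope \<open>i\<close> is determined by the \<open>i\<close> smallest entries.\<close>
definition tang :: "int list \<Rightarrow> nat \<Rightarrow> int \<Rightarrow> int" where
  "tang a i u = int i * u - sum_list (drop (length a - i) a)"

lemma cnt_simps [simp]:
  "cnt [] u = 0" "cnt (x # xs) u = cnt xs u + (if x \<le> u then 1 else 0)"
  "cnt (xs @ ys) u = cnt xs u + cnt ys u"
  by (auto simp: cnt_def)

lemma ar_simps [simp]:
  "ar [] u = 0" "ar (x # xs) u = ar xs u + max 0 (u - x)" "ar (xs @ ys) u = ar xs u + ar ys u"
  by (auto simp: ar_def)

lemma cnt_nonneg [simp]: "0 \<le> cnt xs u"
  by (simp add: cnt_def)

lemma cnt_le_length: "cnt xs u \<le> int (length xs)"
  by (simp add: cnt_def)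

lemma cnt_mono: "u \<le> v \<Longrightarrow> cnt xs u \<le> cnt xs v"
  by (induction xs) auto

text \<open>This makes \<open>ar\<close> the discrete primitive of \<open>cnt\<close>, so
  comparisons of counts integrate to comparisons of areas.\<close>

lemma ar_step: "ar xs (u + 1) = ar xs u + cnt xs u"
  by (induction xs) auto

text \<open>Discrete integration of a lower bound on the slope; applied mostly to differences of
  areas, whose slopes come from \<open>ar_step\<close>.\<close>

lemma step_growth:
  fixes f :: "int \<Rightarrow> int"
  assumes "u \<le> v" and "\<And>x. u \<le> x \<Longrightarrow> x < v \<Longrightarrow> f x + k \<le> f (x + 1)"
  shows "f u + k * (v - u) \<le> f v"
  using assms
proof (induction v rule: int_ge_induct)
  case base then show ?case by simp
next
  case (step v)
  have "f u + k * (v - u) \<le> f v" using step by auto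
  moreover have "f v + k \<le> f (v + 1)" using step by auto
  ultimately show ?case by (simp add: algebra_simps)
qed

lemma ar_convex: "u \<le> v \<Longrightarrow> ar xs u + cnt xs u * (v - u) \<le> ar xs v"
  by (rule step_growth) (auto simp: ar_step intro: cnt_mono)

lemma cnt_all: "(\<And>x. x \<in> set xs \<Longrightarrow> x \<le> u) \<Longrightarrow> cnt xs u = int (length xs)"
  by (induction xs) auto

lemma cnt_none: "(\<And>x. x \<in> set xs \<Longrightarrow> u < x) \<Longrightarrow> cnt xs u = 0"
  by (induction xs) force+

lemma ar_all: "(\<And>x. x \<in> set xs \<Longrightarrow> x \<le> u) \<Longrightarrow> ar xs u = int (length xs) * u - sum_list xs"
  by (induction xs) (auto simp: algebra_simps)

lemma ar_none: "(\<And>x. x \<in> set xs \<Longrightarrow> u \<le> x) \<Longrightarrow> ar xs u = 0"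
  by (induction xs) force+

lemma ar_nonneg: "0 \<le> ar xs u"
  by (induction xs) auto

lemma ar_ge: "int (length xs) * u - sum_list xs \<le> ar xs u"
  by (induction xs) (auto simp: algebra_simps)

lemma cnt_split: "cnt xs u = cnt (take k xs) u + cnt (drop k xs) u"
  by (metis append_take_drop_id cnt_simps(3))

lemma ar_split: "ar xs u = ar (take k xs) u + ar (drop k xs) u"
  by (metis append_take_drop_id ar_simps(3))

lemma sum_list_split: "sum_list xs = sum_list (take k xs) + sum_list (drop k xs :: int list)"
  by (metis append_take_drop_id sum_list_append)

section \<open>Entries of nonincreasing lists versus counts, and the tangent lines\<close>

lemma is_partition_Cons [simp]:
  "is_partition (x # xs) \<longleftrightarrow> (\<forall>y\<in>set xs. y \<le> x) \<and> is_partition xs"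
  by (simp add: is_partition_def)

lemma is_partition_nthD: "is_partition xs \<Longrightarrow> i \<le> j \<Longrightarrow> j < length xs \<Longrightarrow> xs ! j \<le> xs ! i"
  unfolding is_partition_def by (metis le_eq_less_or_eq sorted_wrt_nth_less order_refl)

lemma is_partition_index_mono:
  "is_partition xs \<Longrightarrow> i \<le> j \<Longrightarrow> j \<in> {1..length xs} \<Longrightarrow> xs ! (j - 1) \<le> xs ! (i - 1)"
  by (rule is_partition_nthD) auto

text \<open>The dictionary between entries and counts: in a nonincreasing list an entry is at most
  \<open>u\<close> exactly when it and everything behind it is counted.\<close>

lemma partition_nth_le_iff:
  assumes "is_partition xs" "k < length xs"
  shows "xs ! k \<le> u \<longleftrightarrow> int (length xs) - int k \<le> cnt xs u"
  using assms
proof (induction xs arbitrary: k)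
  case Nil then show ?case by simp
next
  case (Cons x xs)
  show ?case
  proof (cases "x \<le> u")
    case True
    then have "cnt (x # xs) u = int (length (x # xs))"
      using Cons.prems by (intro cnt_all) auto
    moreover have "(x # xs) ! k \<le> x"
      using is_partition_nthD[OF Cons.prems(1), of 0 k] Cons.prems(2) by simp
    ultimately show ?thesis using True by auto
  next
    case False
    show ?thesis
    proof (cases k)
      case 0 then show ?thesis using False cnt_le_length[of xs u] by simp
    next
      case (Suc k')
      then show ?thesis using Cons False by simp
    qed
  qed
qed

lemma partition_drop_le:
  assumes "is_partition xs" "x \<in> set (drop k xs)" "int (length xs) - int k \<le> cnt xs u"
  shows "x \<le> u"
proof -
  obtain i' where "i' < length xs - k" "x = xs ! (k + i')"
    using assms(2) by (auto simp: in_set_conv_nth)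
  then obtain i where i: "i < length xs" "k \<le> i" "x = xs ! i"
    using that[of "k + i'"] by auto
  then show ?thesis using assms partition_nth_le_iff[OF assms(1) i(1)] by auto
qed

lemma partition_take_gt:
  assumes "is_partition xs" "x \<in> set (take k xs)" "cnt xs u \<le> int (length xs) - int k"
  shows "u < x"
proof -
  obtain i where i: "i < length xs" "i < k" "x = xs ! i"
    using assms(2) by (auto simp: in_set_conv_nth intro!: that)
  then show ?thesis using assms partition_nth_le_iff[OF assms(1) i(1), of u] by auto
qed

text \<open>Discarding the largest entries loses nonnegative area, and on the others the positive
  part dominates the linear function.\<close>

lemma tang_le_ar: "i \<le> length a \<Longrightarrow> tang a i u \<le> ar a u"
  using ar_ge[of "drop (length a - i) a" u] ar_nonneg[of "take (length a - i) a" u]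
    ar_split[of a u "length a - i"]
  by (simp add: tang_def)

text \<open>The hypotheses place \<open>i\<close> between the left slope
  \<open>cnt a (u - 1)\<close> and the right slope \<open>cnt a u\<close> of \<open>ar a\<close> at
  \<open>u\<close>, so the line of slope \<open>i\<close> touches there.\<close>

lemma tang_eq_ar:
  assumes "is_partition a" "cnt a (u - 1) \<le> int i" "int i \<le> cnt a u"
  shows "tang a i u = ar a u"
proof -
  have il: "i \<le> length a" using assms(3) cnt_le_length[of a u] by linarith
  have "ar (drop (length a - i) a) u = int i * u - sum_list (drop (length a - i) a)"
    using ar_all[of "drop (length a - i) a" u] partition_drop_le[OF assms(1), of _ "length a - i" u]
      assms(3) il by simp
  moreover have "ar (take (length a - i) a) u = 0"
    using partition_take_gt[OF assms(1), of _ "length a - i" "u - 1"] assms(2) il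
    by (intro ar_none) force
  ultimately show ?thesis using ar_split[of a u "length a - i"] by (simp add: tang_def)
qed

text \<open>Raising the slope by one adds \<open>u\<close> minus the next smallest entry, which is
  nonnegative while that entry is at most \<open>u\<close>.\<close>

lemma tang_mono:
  assumes "is_partition a" "i \<le> k" "int k \<le> cnt a u"
  shows "tang a i u \<le> tang a k u"
  using assms(2,3)
proof (induction k rule: dec_induct)
  case base then show ?case by simp
next
  case (step k)
  have l: "Suc k \<le> length a" using step.prems cnt_le_length[of a u] by linarith
  have "drop (length a - Suc k) a = a ! (length a - Suc k) # drop (length a - k) a"
    using Cons_nth_drop_Suc[of "length a - Suc k" a] l by (simp add: Suc_diff_Suc)
  moreover have "a ! (length a - Suc k) \<le> u"
    using partition_nth_le_iff[OF assms(1), of "length a - Suc k" u] l step.prems by auto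
  ultimately have "tang a k u \<le> tang a (Suc k) u"
    by (simp add: tang_def algebra_simps)
  then show ?case using step by force
qed

lemma tang_shift: "tang a i v = tang a i u + int i * (v - u)"
  by (simp add: tang_def algebra_simps)

section \<open>Generalized majorization through counting functions\<close>

lemma E_nth [simp]: "i < length xs \<Longrightarrow> E xs (int i + 1) = ereal (xs ! i)"
  by (simp add: E_def nat_add_distrib)

lemma sumE_eq:
  assumes "l \<le> r" "r \<le> length xs"
  shows "sumE xs (int l + 1) (int r) = ereal (sum_list (drop l (take r xs)))"
  using assms
proof (induction r rule: dec_induct)
  case base then show ?case by (simp add: sumE_def)
next
  case (step r)
  have "{int l + 1..int (Suc r)} = insert (int r + 1) {int l + 1..int r}"
    using step by auto
  then have "sumE xs (int l + 1) (int (Suc r)) = E xs (int r + 1) + sumE xs (int l + 1) (int r)"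
    by (simp add: sumE_def)
  then show ?case using step by (simp add: take_Suc_conv_app_nth)
qed

lemma sumE_take: "r \<le> length xs \<Longrightarrow> sumE xs 1 (int r) = ereal (sum_list (take r xs))"
  using sumE_eq[of 0 r xs] by simp

lemma E_less_E_iff:
  assumes "1 \<le> i" "i \<le> length g" "j \<le> i"
  shows "E d (int i - int j + 1) < E g (int i) \<longleftrightarrow> i - j \<ge> length d \<or> d ! (i - j) < g ! (i - 1)"
proof -
  have "E g (int i) = ereal (g ! (i - 1))"
    using assms by (simp add: E_def nat_diff_distrib)
  moreover have "E d (int i - int j + 1) = (if i - j < length d then ereal (d ! (i - j)) else -\<infinity>)"
    using assms by (auto simp: E_def nat_diff_distrib of_nat_diff nat_add_distrib)
  ultimately show ?thesis by auto
qed

text \<open>The infinite default entry at nonpositive indices is what forces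
  \<open>j \<le> hj d g j\<close>.\<close>

lemma E_ge_E: "1 \<le> i \<Longrightarrow> i < j \<Longrightarrow> \<not> E d (int i - int j + 1) < E g (int i)"
  by (simp add: E_def)

lemma hj_bounds:
  assumes "length g = length d + length a" "1 \<le> j" "j \<le> length a"
  defines "h \<equiv> hj d g j"
  shows "j \<le> h" "h \<le> length d + j"
    "h - j \<ge> length d \<or> d ! (h - j) < g ! (h - 1)"
    "\<And>i. j \<le> i \<Longrightarrow> i < h \<Longrightarrow> i - j < length d \<and> g ! (i - 1) \<le> d ! (i - j)"
proof -
  let ?P = "\<lambda>i. i \<ge> 1 \<and> E d (int i - int j + 1) < E g (int i)"
  \<comment> \<open>Here the index into \<open>d\<close> is just past its end, so the default minus
    infinity makes the inequality true and the \<open>LEAST\<close> exists.\<close>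
  have P0: "?P (length d + j)"
    using assms E_less_E_iff[of "length d + j" g j d] by simp
  have h: "?P h" unfolding h_def hj_def by (rule LeastI[of ?P, OF P0])
  have least: "\<not> ?P i" if "i < h" for i
    using that unfolding h_def hj_def by (rule not_less_Least)
  show h1: "j \<le> h" using h E_ge_E by (meson linorder_not_less)
  show h2: "h \<le> length d + j" unfolding h_def hj_def by (rule Least_le[of ?P, OF P0])
  show "h - j \<ge> length d \<or> d ! (h - j) < g ! (h - 1)"
    using h E_less_E_iff[of h g j d] h1 h2 assms by auto
  show "i - j < length d \<and> g ! (i - 1) \<le> d ! (i - j)" if "j \<le> i" "i < h" for i
    using least[OF that(2)] E_less_E_iff[of i g j d] that h2 assms by auto
qed

text \<open>The level \<open>h\<^sub>j\<close> is where \<open>cnt g - cnt d\<close> leaves the values up to \<open>s - j\<close> for good, and the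
  partial sum inequality says that the area difference there lies below the tangent of slope \<open>s - j\<close>.\<close>
lemma hj_condition:
  assumes part: "is_partition g" "is_partition d"
    and len: "length g = length d + length a" and j: "1 \<le> j" "j \<le> length a"
    and total: "sum_list g = sum_list d + sum_list a"
  defines "u \<equiv> g ! (hj d g j - 1)"
  shows "cnt g (u - 1) - cnt d (u - 1) \<le> int (length a - j)"
    and "\<And>v. u \<le> v \<Longrightarrow> int (length a - j) < cnt g v - cnt d v"
    and "sumE g 1 (int (hj d g j)) - sumE d 1 (int (hj d g j) - int j) \<le> sumE a 1 (int j)
      \<longleftrightarrow> ar g u - ar d u \<le> tang a (length a - j) u"
proof -
  define h where "h = hj d g j"
  note hb = hj_bounds[OF len j, folded h_def]
  have u: "u = g ! (h - 1)" by (simp add: u_def h_def)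
  have hl: "1 \<le> h" "h \<le> length g" "h - j \<le> length d" using hb j len by auto
  have cg: "cnt g (u - 1) \<le> int (length g) - int h"
    using partition_nth_le_iff[OF part(1), of "h - 1" "u - 1"] hl unfolding u by linarith
  have cg': "int (length g) - int h + 1 \<le> cnt g u"
    using partition_nth_le_iff[OF part(1), of "h - 1" u] hl unfolding u by linarith
  have cd: "int (length d) - int (h - j) \<le> cnt d (u - 1)"
  proof (cases "h - j < length d")
    case True
    then show ?thesis using partition_nth_le_iff[OF part(2) True, of "u - 1"] hb(3) by (auto simp: u)
  next
    case False
    then show ?thesis using cnt_nonneg[of d "u - 1"] by linarith
  qed
  have hj_int: "int (h - j) = int h - int j" using hb by simp
  show "cnt g (u - 1) - cnt d (u - 1) \<le> int (length a - j)"
    using cg cd hj_int len j by simp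
  show "int (length a - j) < cnt g v - cnt d v" if v: "u \<le> v" for v
  proof -
    \<comment> \<open>\<open>r\<close> counts the entries of \<open>g\<close> above
      \<open>v\<close>. If \<open>j \<le> r\<close>, minimality of \<open>h\<close> bounds the last
      of them by \<open>d ! (r - j)\<close>, so at least \<open>r - j + 1\<close> entries of
      \<open>d\<close> exceed \<open>v\<close> too.\<close>
    define r where "r = nat (int (length g) - cnt g v)"
    have r: "int r = int (length g) - cnt g v" "r < h"
      using cnt_le_length[of g v] cnt_mono[OF v, of g] cg' hl by (auto simp: r_def)
    show ?thesis
    proof (cases "j \<le> r")
      case True
      have "r - 1 < length g" "int (r - 1) = int r - 1" using r True j hl by linarith+
      then have "v < g ! (r - 1)"
        using partition_nth_le_iff[OF part(1), of "r - 1" v] r by linarith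
      then have "v < d ! (r - j)" "r - j < length d" using hb(4)[OF True r(2)] by auto
      then have "cnt d v < int (length d) - int (r - j)"
        using partition_nth_le_iff[OF part(2), of "r - j" v] by auto
      then show ?thesis using r True len j by simp
    next
      case False
      then show ?thesis using r cnt_le_length[of d v] len j by simp
    qed
  qed
  have arg: "ar g u = int (length g - h) * u - sum_list (drop h g)"
  proof -
    have "ar (take h g) u = 0"
      using partition_take_gt[OF part(1), of _ h "u - 1"] cg by (intro ar_none) force
    moreover have "ar (drop h g) u = int (length g - h) * u - sum_list (drop h g)"
      using partition_drop_le[OF part(1), of _ h u] cg' ar_all[of "drop h g" u] by simp
    ultimately show ?thesis using ar_split[of g u h] by simp
  qed
  have ard: "ar d u = int (length d - (h - j)) * u - sum_list (drop (h - j) d)"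
  proof -
    \<comment> \<open>Minimality of \<open>h\<close>, used at \<open>h - 1\<close>, puts the first
      \<open>h - j\<close> entries of \<open>d\<close> at or above \<open>u\<close>, where they
      contribute no area.\<close>
    have "cnt d (u - 1) \<le> int (length d) - int (h - j)"
    proof (cases "h = j")
      case False
      then have "g ! (h - 2) \<le> d ! (h - 1 - j)" "h - 1 - j < length d"
        using hb(1) hb(4)[of "h - 1"] by (auto simp: diff_diff_eq numeral_2_eq_2)
      moreover have "u \<le> g ! (h - 2)"
        using hl False hb(1) j unfolding u by (intro is_partition_nthD[OF part(1)]) auto
      ultimately have "cnt d (u - 1) < int (length d) - int (h - 1 - j)"
        using partition_nth_le_iff[OF part(2), of "h - 1 - j" "u - 1"] by auto
      then show ?thesis using False hb(1) by (simp add: of_nat_diff)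
    qed (use cnt_le_length[of d "u - 1"] in simp)
    then have "ar (take (h - j) d) u = 0"
      using partition_take_gt[OF part(2), of _ "h - j" "u - 1"] by (intro ar_none) force
    moreover have "ar (drop (h - j) d) u = int (length d - (h - j)) * u - sum_list (drop (h - j) d)"
      using partition_drop_le[OF part(2), of _ "h - j" "u - 1"] cd
        ar_all[of "drop (h - j) d" u] by force
    ultimately show ?thesis using ar_split[of d u "h - j"] by simp
  qed
  have e1: "int (length g - h) = int (length g) - int h" "int (length d - (h - j)) = int (length d) - int h + int j"
    "int (length a - j) = int (length a) - int j" "int (length g) = int (length d) + int (length a)"
    using hl hb j len by auto
  have "sumE g 1 (int h) - sumE d 1 (int h - int j) \<le> sumE a 1 (int j)
    \<longleftrightarrow> sum_list (take h g) - sum_list (take (h - j) d) \<le> sum_list (take j a)"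
    using sumE_take[of h g] sumE_take[OF hl(3)] sumE_take[of j a] hl(2) j(2)
    unfolding hj_int by (simp flip: of_int_diff)
  also have "\<dots> \<longleftrightarrow> sum_list (drop j a) \<le> sum_list (drop h g) - sum_list (drop (h - j) d)"
    using total sum_list_split[of g h] sum_list_split[of d "h - j"] sum_list_split[of a j] by linarith
  also have "\<dots> \<longleftrightarrow> ar g u - ar d u \<le> tang a (length a - j) u"
    unfolding arg ard tang_def e1 using j by (simp add: algebra_simps)
  finally show "sumE g 1 (int (hj d g j)) - sumE d 1 (int (hj d g j) - int j) \<le> sumE a 1 (int j)
      \<longleftrightarrow> ar g u - ar d u \<le> tang a (length a - j) u"
    unfolding h_def .
qed

lemma interlacing_iff_cnt_le:
  assumes part: "is_partition g" "is_partition d" and len: "length g = length d + l"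
  shows "(\<forall>i\<in>{1..length d}. g ! (i + l - 1) \<le> d ! (i - 1)) \<longleftrightarrow> (\<forall>u. cnt d u \<le> cnt g u)"
proof safe
  fix u assume *: "\<forall>i\<in>{1..length d}. g ! (i + l - 1) \<le> d ! (i - 1)"
  show "cnt d u \<le> cnt g u"
  proof (cases "cnt d u = 0")
    case False
    define k where "k = nat (int (length d) - cnt d u)"
    have k: "int k = int (length d) - cnt d u" "k < length d"
      using cnt_le_length[of d u] False cnt_nonneg[of d u] unfolding k_def by linarith+
    have "d ! k \<le> u" using partition_nth_le_iff[OF part(2) k(2), of u] k by simp
    moreover have "g ! (k + l) \<le> d ! k" using * k(2) by (auto dest: bspec[of _ _ "Suc k"])
    ultimately show ?thesis using partition_nth_le_iff[OF part(1), of "k + l" u] k len by simp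
  qed simp
next
  fix i assume *: "\<forall>u. cnt d u \<le> cnt g u" and i: "i \<in> {1..length d}"
  let ?u = "d ! (i - 1)"
  have "int (length d) - int (i - 1) \<le> cnt d ?u"
    using partition_nth_le_iff[OF part(2), of "i - 1" ?u] i by auto
  also have "\<dots> \<le> cnt g ?u" using * by simp
  finally show "g ! (i + l - 1) \<le> ?u"
    using partition_nth_le_iff[OF part(1), of "i + l - 1" ?u] len i by auto
qed

text \<open>The existential leaves no choice: its first two clauses force \<open>u\<close> to follow
  immediately the last place where \<open>cnt g - cnt d\<close> is at most \<open>i\<close>. For
  \<open>i = length a - j\<close> this is the entry of \<open>g\<close> at index
  \<open>hj d g j\<close>, so that index disappears from the criterion.\<close>

lemma gmaj_iff:
  assumes part: "is_partition g" "is_partition d" and len: "length g = length d + length a"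
  shows "gmaj g d a \<longleftrightarrow> (\<forall>u. cnt d u \<le> cnt g u) \<and> sum_list g = sum_list d + sum_list a \<and>
    (\<forall>i<length a. \<exists>u. cnt g (u - 1) - cnt d (u - 1) \<le> int i \<and>
        (\<forall>v\<ge>u. int i < cnt g v - cnt d v) \<and> ar g u - ar d u \<le> tang a i u)"
    (is "_ \<longleftrightarrow> _ \<and> ?T \<and> (\<forall>i<_. ?Q i)")
proof -
  have main: "(sumE g 1 (int (hj d g j)) - sumE d 1 (int (hj d g j) - int j) \<le> sumE a 1 (int j))
      \<longleftrightarrow> ?Q (length a - j)" if j: "1 \<le> j" "j \<le> length a" and T: ?T for j
  proof -
    note hc = hj_condition[OF part len j T]
    have "u = g ! (hj d g j - 1)"
      if u: "cnt g (u - 1) - cnt d (u - 1) \<le> int (length a - j)"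
        "\<forall>v\<ge>u. int (length a - j) < cnt g v - cnt d v" for u
      using u(1) spec[OF u(2), of "g ! (hj d g j - 1) - 1"] hc(1) hc(2)[of "u - 1"] by linarith
    then show ?thesis using hc by metis
  qed
  have shift: "(\<forall>i<length a. ?Q i) \<longleftrightarrow> (\<forall>j\<in>{1..length a}. ?Q (length a - j))"
  proof safe
    fix i assume "\<forall>j\<in>{1..length a}. ?Q (length a - j)" and "i < length a"
    then have "?Q (length a - (length a - i))" by (elim bspec) auto
    then show "?Q i" using \<open>i < length a\<close> by simp
  next
    fix j assume "\<forall>i<length a. ?Q i" and "j \<in> {1..length a}"
    then show "?Q (length a - j)" by (elim allE[where x = "length a - j"] impE) auto
  qed
  show ?thesis
  proof (cases ?T)
    case True
    have "(\<forall>j\<in>{1..length a}.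
        sumE g 1 (int (hj d g j)) - sumE d 1 (int (hj d g j) - int j) \<le> sumE a 1 (int j))
      \<longleftrightarrow> (\<forall>j\<in>{1..length a}. ?Q (length a - j))"
      by (rule ball_cong[OF refl], rule main) (use True in simp_all)
    then show ?thesis
      unfolding gmaj_def interlacing_iff_cnt_le[OF part len] shift by blast
  next
    case False
    then show ?thesis unfolding gmaj_def by blast
  qed
qed

lemma set_upper_bound:
  fixes L :: "'a :: linorder"
  obtains U where "L \<le> U" "\<And>x. x \<in> set xs \<Longrightarrow> x \<le> U"
proof
  show "L \<le> Max (insert L (set xs))" "\<And>x. x \<in> set xs \<Longrightarrow> x \<le> Max (insert L (set xs))"
    by (auto intro: Max_ge)
qed

lemma set_lower_bound:
  fixes U :: "'a :: linorder"
  obtains L where "L \<le> U" "\<And>x. x \<in> set xs \<Longrightarrow> L \<le> x"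
proof
  show "Min (insert U (set xs)) \<le> U" "\<And>x. x \<in> set xs \<Longrightarrow> Min (insert U (set xs)) \<le> x"
    by (auto intro: Min_le)
qed

text \<open>The slope \<open>i\<close> is the minimum of \<open>cnt g - cnt d\<close> from \<open>u\<close> on.\<close>
lemma gmaj_below_tang:
  assumes part: "is_partition g" "is_partition d" and len: "length g = length d + length a"
    and maj: "gmaj g d a"
  obtains i where "i \<le> length a" "int i \<le> cnt g u - cnt d u" "ar g u - ar d u \<le> tang a i u"
proof -
  let ?w = "\<lambda>v. cnt g v - cnt d v"
  note G = maj[unfolded gmaj_iff[OF part len]]
  obtain U where "u \<le> U" "\<And>x. x \<in> set (g @ d) \<Longrightarrow> x \<le> U"
    using set_upper_bound[of u "g @ d"] by blast
  then have U: "u \<le> U" "\<And>x. x \<in> set g \<Longrightarrow> x \<le> U" "\<And>x. x \<in> set d \<Longrightarrow> x \<le> U" by auto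
  have wU: "?w v = int (length a)" if "U \<le> v" for v
    using cnt_all[of g v] cnt_all[of d v] U that len by force
  define i where "i = nat (Min (?w ` {u..U}))"
  have fin: "finite (?w ` {u..U})" "?w ` {u..U} \<noteq> {}" using U by auto
  obtain v where v: "v \<in> {u..U}" "Min (?w ` {u..U}) = ?w v" using Min_in[OF fin] by auto
  have iv: "int i = ?w v" using v G by (auto simp: i_def)
  have i_le: "int i \<le> ?w x" if "u \<le> x" for x
  proof (cases "x \<le> U")
    case True then show ?thesis using Min_le[OF fin(1), of "?w x"] v iv that by auto
  next
    case False
    then have "?w x = ?w U" using wU[of x] wU[of U] by simp
    then show ?thesis using Min_le[OF fin(1), of "?w U"] v iv U by auto
  qed
  have ile: "i \<le> length a" using i_le[of U] wU[of U] U by simp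
  \<comment> \<open>From \<open>u\<close> on the area difference rises with slope at least
    \<open>i\<close>, so a tangent bound of slope \<open>i\<close> at a later point carries back to
    \<open>u\<close>.\<close>
  have grow: "ar g u - ar d u + int i * (x - u) \<le> ar g x - ar d x" if "u \<le> x" for x
    using that by (rule step_growth) (use i_le in \<open>force simp: ar_step\<close>)
  have "ar g u - ar d u \<le> tang a i u"
  proof (cases "i < length a")
    case True
    then obtain x where x: "\<forall>y\<ge>x. int i < ?w y" "ar g x - ar d x \<le> tang a i x" using G by blast
    \<comment> \<open>Since \<open>v\<close> attains the minimum \<open>i\<close>, the last ascent
      through level \<open>i\<close> lies beyond it, hence to the right of \<open>u\<close>.\<close>
    have "\<not> x \<le> v" using x(1) iv by force
    then have "u \<le> x" using v by simp
    then show ?thesis using grow x(2) tang_shift[of a i x u] by force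
  next
    case False
    then have i: "i = length a" using ile by simp
    \<comment> \<open>No ascent belongs to the top level; there the total sum gives equality to the
      right of all entries.\<close>
    have "ar g U - ar d U = tang a i U"
      using ar_all[of g U] ar_all[of d U] U len G i by (auto simp: tang_def algebra_simps)
    then show ?thesis using grow[of U] U tang_shift[of a i U u] by simp
  qed
  then show ?thesis using that[OF ile] i_le[of u] by simp
qed

lemma gmaj_area_le:
  assumes "is_partition g" "is_partition d" "length g = length d + length a" "gmaj g d a"
  shows "ar g u \<le> ar d u + ar a u"
proof -
  obtain i where "i \<le> length a" "ar g u - ar d u \<le> tang a i u"
    using gmaj_below_tang[OF assms] by metis
  then show ?thesis using tang_le_ar[of i a u] by simp
qed

text \<open>Descents below a level that violate the tangent bound are harmless as long as \<open>ar a\<close> still has slope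
  at most that level: then the bound is inherited from \<open>ar g \<le> ar d + ar a\<close> where the slope reaches it.\<close>
lemma gmajI:
  assumes part: "is_partition g" "is_partition d" "is_partition a"
    and len: "length g = length d + length a"
    and dom: "\<And>u. cnt d u \<le> cnt g u" and total: "sum_list g = sum_list d + sum_list a"
    and area: "\<And>u. ar g u \<le> ar d u + ar a u"
    and descent: "\<And>u i. i < length a \<Longrightarrow> cnt g u - cnt d u \<le> int i
      \<Longrightarrow> int i < cnt g (u - 1) - cnt d (u - 1)
      \<Longrightarrow> ar g u - ar d u \<le> tang a i u \<or> cnt a (u - 1) \<le> int i"
  shows "gmaj g d a"
  unfolding gmaj_iff[OF part(1,2) len]
proof (intro conjI allI impI)
  fix i assume i: "i < length a"
  let ?w = "\<lambda>v. cnt g v - cnt d v" and ?W = "\<lambda>v. ar g v - ar d v"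
  obtain U where U: "\<And>x. x \<in> set (g @ d) \<Longrightarrow> x \<le> U" using set_upper_bound[of 0] by blast
  obtain L where L: "L \<le> U" "\<And>x. x \<in> set (g @ d @ a) \<Longrightarrow> L \<le> x"
    using set_lower_bound[of U "g @ d @ a"] by blast
  have wU: "?w v = int (length a)" if "U \<le> v" for v
    using cnt_all[of g v] cnt_all[of d v] U that len by force
  have wL: "?w (L - 1) = 0" "cnt a (L - 1) = 0"
    using cnt_none[of g "L - 1"] cnt_none[of d "L - 1"] cnt_none[of a "L - 1"] L by force+
  \<comment> \<open>While \<open>?w\<close> stays at most \<open>i\<close>, the area difference
    gains at most \<open>i\<close> per step and the tangent bound persists. It starts where the
    slope of \<open>ar a\<close> passes \<open>i\<close>, by the area hypothesis, and restarts at
    each descent.\<close>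
  have claim: "?w (u - 1) \<le> int i \<longrightarrow> ?W u \<le> tang a i u \<or> cnt a (u - 1) \<le> int i" if "L \<le> u" for u
    using that
  proof (induction u rule: int_ge_induct)
    case base then show ?case using wL by simp
  next
    case (step u)
    show ?case
    proof (intro impI)
      assume "?w (u + 1 - 1) \<le> int i"
      then have w: "?w u \<le> int i" by simp
      have Wu: "?W (u + 1) \<le> ?W u + int i" using w by (simp add: ar_step)
      show "?W (u + 1) \<le> tang a i (u + 1) \<or> cnt a (u + 1 - 1) \<le> int i"
      proof (cases "cnt a u \<le> int i")
        case False
        have "?W u \<le> tang a i u"
        proof (cases "cnt a (u - 1) \<le> int i")
          case True
          then show ?thesis using tang_eq_ar[OF part(3) True] False area[of u] by simp
        next
          case nle: False
          then show ?thesis using step.IH descent[OF i w] by force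
        qed
        then show ?thesis using Wu tang_shift[of a i "u + 1" u] by (simp add: algebra_simps)
      qed simp
    qed
  qed
  define V where "V = {v\<in>{L - 1..U}. ?w v \<le> int i}"
  have V: "finite V" "L - 1 \<in> V"
    unfolding V_def using L wL by (auto intro: finite_subset[of _ "{L - 1..U}"])
  define u where "u = Max V + 1"
  have u: "L \<le> u" "?w (u - 1) \<le> int i"
    using Max_ge[OF V] Max_in[OF V(1)] V(2) by (auto simp: u_def V_def)
  have gt: "int i < ?w v" if "u \<le> v" for v
  proof (rule ccontr)
    assume n: "\<not> int i < ?w v"
    then have "v < U" using wU[of v] i by (cases "U \<le> v") auto
    then have "v \<in> V" using n u that by (auto simp: V_def)
    then show False using Max_ge[OF V(1)] that by (force simp: u_def)
  qed
  have "?W u \<le> tang a i u"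
  proof (rule ccontr)
    assume n: "\<not> ?W u \<le> tang a i u"
    then have ca: "cnt a (u - 1) \<le> int i" using claim u by blast
    \<comment> \<open>The slope of \<open>ar a\<close> passes \<open>i\<close> at this entry, so the
      tangent touches \<open>ar a\<close> there. The area difference has slope above
      \<open>i\<close> from \<open>u\<close> on, so a violation at \<open>u\<close> would persist up
      to \<open>x\<close> and contradict the area bound.\<close>
    define x where "x = a ! (length a - i - 1)"
    have "x \<le> v \<longleftrightarrow> int i < cnt a v" for v
      using partition_nth_le_iff[OF part(3), of "length a - i - 1" v] i
      by (simp add: x_def of_nat_diff less_iff_succ_less_eq add.commute)
    from this[of "x - 1"] this[of x] this[of "u - 1"] ca
    have x: "cnt a (x - 1) \<le> int i" "int i \<le> cnt a x" "u \<le> x" by auto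
    have "?W u + int i * (x - u) \<le> ?W x"
      using x(3) by (rule step_growth) (use gt in \<open>force simp: ar_step\<close>)
    then show False using n tang_eq_ar[OF part(3) x(1,2)] area[of x] tang_shift[of a i x u] by simp
  qed
  then show "\<exists>u. ?w (u - 1) \<le> int i \<and> (\<forall>v\<ge>u. int i < ?w v) \<and> ?W u \<le> tang a i u"
    using u gt by blast
qed (use dom total in auto)

section \<open>Comparison and invariance of counts and areas\<close>

lemma ar_mono:
  assumes "\<And>v. v < u \<Longrightarrow> cnt xs v \<le> cnt ys v"
  shows "ar xs u \<le> ar ys u"
proof -
  obtain L where L: "L \<le> u" "\<And>x. x \<in> set (xs @ ys) \<Longrightarrow> L \<le> x"
    using set_lower_bound[of u "xs @ ys"] by blast
  have "(ar ys L - ar xs L) + 0 * (u - L) \<le> ar ys u - ar xs u"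
    using L assms by (intro step_growth) (auto simp: ar_step)
  moreover have "ar ys L = 0" "ar xs L = 0" using L by (auto intro: ar_none)
  ultimately show ?thesis by simp
qed

lemma ar_cong: "(\<And>v. v < u \<Longrightarrow> cnt xs v = cnt ys v) \<Longrightarrow> ar xs u = ar ys u"
  by (intro antisym ar_mono) auto

lemma cnt_mset: "mset xs = mset ys \<Longrightarrow> cnt xs u = cnt ys u"
  unfolding cnt_def by (metis mset_filter size_mset)

lemma ar_mset: "mset xs = mset ys \<Longrightarrow> ar xs u = ar ys u"
  unfolding ar_def by (metis mset_map sum_mset_sum_list)

lemma is_partition_sorted: "is_partition (rev (sort xs))"
  by (simp add: is_partition_def sorted_wrt_rev)

section \<open>Truncating a multiset to a prescribed sum\<close>

lemma sum_list_min_Suc: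
  "sum_list (map (min (t + 1)) xs) = sum_list (map (min t) xs) + int (length xs) - cnt xs t"
  for t :: int
  by (induction xs) auto

lemma is_partition_replicate: "is_partition (replicate k x)"
  by (induction k) (auto simp: is_partition_def)

text \<open>Pad \<open>X\<close> with copies of \<open>U\<close> to length \<open>L\<close>; the
  area hypothesis says exactly that the padded sum is at least \<open>t\<close>. Lower a cap until
  the capped sum no longer exceeds \<open>t\<close>, then repair the deficit by lifting the leading
  \<open>r\<close> entries to one above the cap.\<close>

lemma truncation:
  assumes L: "0 < L" "length X \<le> L" and U: "\<And>x. x \<in> set X \<Longrightarrow> x \<le> U"
    and total: "ar X U \<le> int L * U - t"
  obtains g T where "length g = L" "is_partition g" "sum_list g = t"
    "\<And>u. u < T \<Longrightarrow> cnt g u = cnt X u" "cnt X T \<le> cnt g T" "\<And>u. T < u \<Longrightarrow> cnt g u = int L"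
proof -
  define Y where "Y = replicate (L - length X) U @ rev (sort X)"
  have lenY: "length Y = L" using L by (simp add: Y_def)
  have partY: "is_partition Y"
    using is_partition_sorted[of X] is_partition_replicate[of _ U] U
    by (auto simp: Y_def is_partition_def sorted_wrt_append)
  have YU: "y \<le> U" if "y \<in> set Y" for y using that U by (auto simp: Y_def)
  have cntY: "cnt Y u = cnt X u" if "u < U" for u
  proof -
    have "cnt (replicate (L - length X) U) u = 0" using that by (intro cnt_none) auto
    then show ?thesis using cnt_mset[of "rev (sort X)" X u] by (simp add: Y_def)
  qed
  have "sum_list (rev (sort X)) = sum_list X" by (metis mset_rev mset_sort sum_mset_sum_list)
  then have sumY: "t \<le> sum_list Y"
    using total ar_all[of X U] U L
    by (simp add: Y_def sum_list_replicate of_nat_diff algebra_simps)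
  define f where "f \<theta> = sum_list (map (min \<theta>) Y)" for \<theta>
  have fU: "f U = sum_list Y"
    unfolding f_def using YU by (metis map_idI min.absorb2)
  have f_le: "f \<theta> \<le> int L * \<theta>" for \<theta>
  proof -
    have "sum_list (map (min \<theta>) xs) \<le> int (length xs) * \<theta>" for xs
      by (induction xs) (auto simp: algebra_simps)
    then show ?thesis using lenY by (auto simp: f_def)
  qed
  \<comment> \<open>The cap is \<open>- \<bar>t\<bar>\<close>, low enough because there is at least
    one entry. If \<open>U\<close> is already below that value, no lowering is required.\<close>
  have "f (U - int (nat (U + \<bar>t\<bar>) )) \<le> t" if "U \<ge> - \<bar>t\<bar>"
  proof -
    have "f (U - int (nat (U + \<bar>t\<bar>))) \<le> int L * (- \<bar>t\<bar>)" using f_le[of "- \<bar>t\<bar>"] that by simp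
    also have "\<dots> \<le> - \<bar>t\<bar>" using L mult_right_mono[of 1 "int L" "\<bar>t\<bar>"] by simp
    finally show ?thesis by simp
  qed
  moreover have "f (U - int 0) \<le> t" if "U < - \<bar>t\<bar>"
  proof -
    have "int L * U \<le> 1 * U" using L that by (intro mult_right_mono_neg) auto
    then show ?thesis using f_le[of U] that by simp
  qed
  ultimately have ex: "\<exists>n. f (U - int n) \<le> t" by (meson not_le)
  define n where "n = (LEAST n. f (U - int n) \<le> t)"
  define T where "T = U - int n"
  define r where "r = nat (t - f T)"
  have fT: "f T \<le> t" unfolding T_def n_def by (rule LeastI_ex[OF ex])
  have r: "int r = t - f T" using fT by (simp add: r_def)
  \<comment> \<open>For \<open>n > 0\<close> the cap \<open>T + 1\<close> overshoots
    \<open>t\<close>, and it gains one per entry above \<open>T\<close>; so the deficit is smaller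
    than the number of such entries and only these get lifted. For \<open>n = 0\<close> the deficit
    is zero.\<close>
  have r_le: "int r \<le> int L - cnt Y T"
  proof (cases n)
    case 0
    then show ?thesis using fU sumY r cnt_le_length[of Y T] lenY by (simp add: T_def)
  next
    case (Suc k)
    then have "\<not> f (U - int k) \<le> t" using not_less_Least[of k "\<lambda>n. f (U - int n) \<le> t"] n_def by simp
    moreover have "U - int k = T + 1" using Suc by (simp add: T_def)
    ultimately show ?thesis using sum_list_min_Suc[of T Y] lenY r by (simp add: f_def)
  qed
  have rL: "r \<le> L" using r_le cnt_nonneg[of Y T] by linarith
  define g where "g = replicate r (T + 1) @ map (min T) (drop r Y)"
  have big: "T < y" if "y \<in> set (take r Y)" for y
    using partition_take_gt[OF partY that, of T] r_le lenY by simp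
  have low: "cnt (map (min T) xs) u = cnt xs u" if "u < T" for xs u
    using that by (induction xs) auto
  have TU: "T \<le> U" by (simp add: T_def)
  show ?thesis
  proof (rule that[of g T])
    show "length g = L" using lenY rL by (simp add: g_def)
    have "is_partition (drop r Y)" using partY by (simp add: is_partition_def sorted_wrt_drop)
    then show "is_partition g"
      using is_partition_replicate[of r "T + 1"] unfolding g_def is_partition_def
      by (auto simp: sorted_wrt_append sorted_wrt_map elim!: sorted_wrt_mono_rel[rotated])
    have "map (min T) (take r Y) = map (\<lambda>_. T) (take r Y)" using big by (intro map_cong) force+
    then have "sum_list (map (min T) (take r Y)) = int r * T"
      using lenY rL by (simp add: sum_list_triv min_absorb2 del: map_eq_conv)
    moreover have "f T = sum_list (map (min T) (take r Y)) + sum_list (map (min T) (drop r Y))"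
      unfolding f_def by (metis append_take_drop_id map_append sum_list_append)
    moreover have "sum_list g = int r * T + int r + sum_list (map (min T) (drop r Y))"
      by (simp add: g_def sum_list_replicate algebra_simps)
    ultimately show "sum_list g = t" using r by linarith
    show "cnt g u = cnt X u" if "u < T" for u
    proof -
      have "cnt (take r Y) u = 0" using big that by (intro cnt_none) force
      moreover have "cnt (replicate r (T + 1)) u = 0" using that by (intro cnt_none) auto
      ultimately show ?thesis
        using cnt_split[of Y u r] low[OF that] cntY[of u] that TU by (simp add: g_def)
    qed
    show "cnt g u = int L" if "T < u" for u
      using cnt_all[of g u] \<open>length g = L\<close> that by (force simp: g_def)
    have "cnt (map (min T) (drop r Y)) T = int (L - r)"
      using lenY by (subst cnt_all) auto
    then have "int L - int r \<le> cnt g T" using rL by (simp add: g_def of_nat_diff)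
    moreover have "cnt X T \<le> cnt Y T"
      using cntY[of T] cnt_all[of Y T] YU TU cnt_le_length[of X T] L lenY by (cases "T < U") force+
    ultimately show "cnt X T \<le> cnt g T" using r_le by linarith
  qed
qed

text \<open>Below \<open>T\<close> everything is inherited from \<open>X\<close>. Above
  \<open>T\<close> all of \<open>g\<close> is counted, so \<open>cnt g - cnt d\<close> is at least
  \<open>length a\<close>: no relevant level is left downwards, and the total sum bounds the area by
  the tangent of slope \<open>length a\<close>.\<close>

lemma gmaj_truncation:
  assumes part: "is_partition g" "is_partition d" "is_partition a"
    and len: "length g = length d + length a" and total: "sum_list g = sum_list d + sum_list a"
    and dom: "\<And>u. cnt d u \<le> cnt X u" and area: "\<And>u. ar X u \<le> ar d u + ar a u"
    and descent: "\<And>u i. cnt X u - cnt d u \<le> int i \<Longrightarrow> int i < cnt X (u - 1) - cnt d (u - 1)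
      \<Longrightarrow> ar X u - ar d u \<le> tang a i u \<or> cnt a (u - 1) \<le> int i"
    and g: "\<And>u. u < T \<Longrightarrow> cnt g u = cnt X u" "cnt X T \<le> cnt g T"
      "\<And>u. T < u \<Longrightarrow> cnt g u = int (length d + length a)"
  shows "gmaj g d a"
proof (rule gmajI[OF part len _ total])
  show "cnt d u \<le> cnt g u" for u
    using g(1,3)[of u] dom[of u] cnt_le_length[of d u] g(2) by (cases u T rule: linorder_cases) auto
  have arX: "ar g u = ar X u" if "u \<le> T" for u using that g(1) by (intro ar_cong) auto
  show "ar g u \<le> ar d u + ar a u" for u
  proof (cases "u \<le> T")
    case True then show ?thesis using arX area by simp
  next
    case False
    obtain U where "u \<le> U" "\<And>x. x \<in> set (g @ d) \<Longrightarrow> x \<le> U"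
    using set_upper_bound[of u "g @ d"] by blast
    then have U: "u \<le> U" "\<And>x. x \<in> set g \<Longrightarrow> x \<le> U" "\<And>x. x \<in> set d \<Longrightarrow> x \<le> U" by auto
    have "(ar g u - ar d u) + int (length a) * (U - u) \<le> ar g U - ar d U"
      using U(1)
    proof (rule step_growth)
      show "ar g x - ar d x + int (length a) \<le> ar g (x + 1) - ar d (x + 1)" if "u \<le> x" for x
        using g(3)[of x] that False cnt_le_length[of d x] by (simp add: ar_step)
    qed
    moreover have "ar g U - ar d U = tang a (length a) U"
      using ar_all[of g U] ar_all[of d U] U len total by (auto simp: tang_def algebra_simps)
    ultimately show ?thesis
      using tang_le_ar[of "length a" a u] tang_shift[of a "length a" U u] by simp
  qed
  show "ar g u - ar d u \<le> tang a i u \<or> cnt a (u - 1) \<le> int i"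
    if i: "i < length a" "cnt g u - cnt d u \<le> int i" "int i < cnt g (u - 1) - cnt d (u - 1)" for u i
  proof (cases "u \<le> T")
    case True
    \<comment> \<open>At \<open>u = T\<close> the inequality \<open>cnt X T \<le> cnt g T\<close>
      suffices: a descent of \<open>g\<close> is then one of \<open>X\<close>, and the areas at
      \<open>T\<close> depend only on counts below \<open>T\<close>.\<close>
    then show ?thesis
      using descent[of u i] i arX g(1)[of "u - 1"] g(1)[of u] g(2) by (cases "u = T") auto
  next
    case False
    then show ?thesis using g(3)[of u] i cnt_le_length[of d u] by simp
  qed
qed

section \<open>The selection rule for one side\<close>

definition sel :: "int list \<Rightarrow> nat set \<Rightarrow> int list" where
  "sel xs I = map (\<lambda>i. xs ! (i - 1)) (sorted_list_of_set I)"

abbreviation compl_in :: "int list \<Rightarrow> nat set \<Rightarrow> nat set" where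
  "compl_in xs I \<equiv> {1..length xs} - I"

text \<open>The excess of selected \<open>c\<close>'s over unselected \<open>d\<close>'s when \<open>d\<^sub>j\<close> is processed, i.e. \<open>s + 1 - q\<^sub>j\<close>.\<close>
definition rest :: "int list \<Rightarrow> int list \<Rightarrow> nat set \<Rightarrow> nat set \<Rightarrow> nat \<Rightarrow> int" where
  "rest c d S D j = cnt (sel c S) (d ! (j - 1)) - int (card {i \<in> compl_in d D. j < i})"

text \<open>The first alternative is rule (a) and the second one rule (b) of the construction.\<close>
definition greedy :: "int list \<Rightarrow> int list \<Rightarrow> int list \<Rightarrow> nat set \<Rightarrow> nat set \<Rightarrow> bool" where
  "greedy a c d S D \<longleftrightarrow> (\<forall>j\<in>{1..length d}. j \<notin> D \<longleftrightarrow> 1 \<le> rest c d S D j \<and>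
     (cnt a (d ! (j - 1) - 1) < rest c d S D j \<or>
      ar (sel c S) (d ! (j - 1)) - ar (sel d (compl_in d D)) (d ! (j - 1))
        \<le> tang a (nat (rest c d S D j - 1)) (d ! (j - 1))))"

lemma set_sel: "finite I \<Longrightarrow> set (sel xs I) = (\<lambda>i. xs ! (i - 1)) ` I"
  by (simp add: sel_def)

lemma length_sel: "length (sel xs I) = card I"
  by (simp add: sel_def)

lemma mset_sel: "mset (sel xs I) = image_mset (\<lambda>i. xs ! (i - 1)) (mset_set I)"
  by (simp add: sel_def mset_map flip: sorted_list_of_mset_set)

lemma sum_list_sel_filter:
  "finite I \<Longrightarrow> sum_list (filter P (sel xs I)) = (\<Sum>i\<in>{i\<in>I. P (xs ! (i - 1))}. xs ! (i - 1))"
  by (simp add: sel_def filter_map o_def sum_list_distinct_conv_sum_set)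

lemma cnt_sel:
  assumes "finite I"
  shows "cnt (sel xs I) u = int (card {i\<in>I. xs ! (i - 1) \<le> u})"
proof -
  let ?l = "filter (\<lambda>i. xs ! (i - 1) \<le> u) (sorted_list_of_set I)"
  have "card (set ?l) = length ?l" by (rule distinct_card) simp
  moreover have "set ?l = {i\<in>I. xs ! (i - 1) \<le> u}" using assms by auto
  ultimately show ?thesis by (simp add: cnt_def sel_def filter_map o_def)
qed

lemma sel_all: "sel xs {1..length xs} = xs"
proof -
  have "sorted_list_of_set {1..length xs} = [1..<Suc (length xs)]"
    using sorted_list_of_set_range[of 1 "Suc (length xs)"] by (simp add: atLeastLessThanSuc_atLeastAtMost)
  then show ?thesis by (intro nth_equalityI) (simp_all add: sel_def del: upt_Suc)
qed

lemma cnt_ar_compl: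
  assumes "D \<subseteq> {1..length d}"
  shows "cnt d u = cnt (sel d D) u + cnt (sel d (compl_in d D)) u"
    and "ar d u = ar (sel d D) u + ar (sel d (compl_in d D)) u"
proof -
  have "{1..length d} = D \<union> compl_in d D" "D \<inter> compl_in d D = {}" using assms by auto
  then have "mset_set {1..length d} = mset_set D + mset_set (compl_in d D)"
    using mset_set_Union[of D "compl_in d D"] finite_subset[OF assms] by simp
  then have "mset (sel d {1..length d}) = mset (sel d D @ sel d (compl_in d D))"
    by (simp add: mset_sel)
  then have m: "mset d = mset (sel d D @ sel d (compl_in d D))" by (simp only: sel_all)
  show "cnt d u = cnt (sel d D) u + cnt (sel d (compl_in d D)) u"
    "ar d u = ar (sel d D) u + ar (sel d (compl_in d D)) u"
    using cnt_mset[OF m] ar_mset[OF m] by auto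
qed

lemma cnt_less_imp_between:
  assumes "cnt xs u < cnt xs v"
  obtains x where "x \<in> set xs" "u < x" "x \<le> v"
proof -
  have "\<exists>x\<in>set xs. u < x \<and> x \<le> v"
    using assms by (induction xs) (auto split: if_splits)
  then show ?thesis using that by blast
qed

text \<open>Several equal unselected \<open>d\<close>'s make the count difference fall by several
  levels at one value; the rank singles out the index responsible for a given level.\<close>

lemma exists_rank:
  fixes K :: "nat set"
  assumes "finite K" "r < card K"
  shows "\<exists>j\<in>K. card {t\<in>K. j < t} = r"
  using assms
proof (induction r arbitrary: K)
  case 0
  then have K: "K \<noteq> {}" by auto
  then have "{t\<in>K. Max K < t} = {}" using Max_ge[OF 0(1)] by (auto simp: not_less)
  then show ?case using Max_in[OF 0(1) K] by (metis card.empty)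
next
  case (Suc r)
  have K: "K \<noteq> {}" using Suc.prems by auto
  have M: "Max K \<in> K" using Max_in[OF Suc.prems(1) K] .
  have "r < card (K - {Max K})" using Suc.prems M by simp
  then obtain j where j: "j \<in> K - {Max K}" "card {t\<in>K - {Max K}. j < t} = r"
    using Suc.IH[of "K - {Max K}"] Suc.prems(1) by auto
  have "j < Max K" using Max_ge[OF Suc.prems(1), of j] j by force
  then have "{t\<in>K. j < t} = insert (Max K) {t\<in>K - {Max K}. j < t}" using M by auto
  then have "card {t\<in>K. j < t} = Suc r" using j Suc.prems(1) by simp
  then show ?case using j(1) by blast
qed

section \<open>Consequences of the selection rule on one side\<close>

context
  fixes a c d :: "int list" and S D :: "nat set"
  assumes part: "is_partition a" "is_partition c" "is_partition d"
    and S: "S \<subseteq> {1..length c}" and D: "D \<subseteq> {1..length d}"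
    and disj: "\<forall>x\<in>set c. \<forall>y\<in>set d. x \<noteq> y"
    and greedy: "greedy a c d S D"
begin

private abbreviation "Dn \<equiv> compl_in d D"
private abbreviation "X \<equiv> sel c S @ sel d D"

lemma fin: "finite S" "finite D"
  using S D finite_subset by blast+

lemma cnt_X: "cnt X u - cnt d u = cnt (sel c S) u - cnt (sel d Dn) u"
  and ar_X: "ar X u - ar d u = ar (sel c S) u - ar (sel d Dn) u"
  using cnt_ar_compl[OF D, of u] by auto

lemma greedyD:
  assumes "j \<in> {1..length d}" "d ! (j - 1) = u"
  shows "j \<notin> D \<longleftrightarrow> 1 \<le> rest c d S D j \<and>
    (cnt a (u - 1) < rest c d S D j \<or> ar X u - ar d u \<le> tang a (nat (rest c d S D j - 1)) u)"
  using greedy assms unfolding greedy_def ar_X by blast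

text \<open>\<open>rest\<close> subtracts only unselected indices behind \<open>j\<close>, while the
  count difference at \<open>u\<close> subtracts every unselected entry up to \<open>u\<close>, and
  no selected \<open>c\<close> is gained in between.\<close>

lemma rest_ge:
  assumes "j \<in> {1..length d}" "d ! (j - 1) \<le> u" "cnt (sel c S) u \<le> cnt (sel c S) (d ! (j - 1))"
  shows "cnt X u - cnt d u \<le> rest c d S D j"
proof -
  have "d ! (i - 1) \<le> u" if "i \<in> Dn" "j < i" for i
    using is_partition_index_mono[OF part(3), of j i] that assms(2) by force
  then have "{i \<in> Dn. j < i} \<subseteq> {i \<in> Dn. d ! (i - 1) \<le> u}" by auto
  then have "card {i \<in> Dn. j < i} \<le> card {i \<in> Dn. d ! (i - 1) \<le> u}"
    by (intro card_mono) auto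
  then show ?thesis
    using assms(3) unfolding cnt_X rest_def by (simp add: cnt_sel)
qed

text \<open>The first unselected index with value at most \<open>u\<close> has all others of this
  kind behind it, so \<open>1 \<le> rest\<close> at that single index pays for all of them.\<close>

lemma greedy_dominates: "cnt d u \<le> cnt X u"
proof -
  define K where "K = {i \<in> Dn. d ! (i - 1) \<le> u}"
  have "int (card K) \<le> cnt (sel c S) u"
  proof (cases "K = {}")
    case False
    define j where "j = Min K"
    have fK: "finite K" by (simp add: K_def)
    have j: "j \<in> K" "\<And>i. i \<in> K \<Longrightarrow> j \<le> i" using False fK by (auto simp: j_def)
    have "K \<subseteq> insert j {i \<in> Dn. j < i}" using j(2) by (force simp: K_def)
    then have "card K \<le> card (insert j {i \<in> Dn. j < i})" by (intro card_mono) auto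
    also have "\<dots> \<le> Suc (card {i \<in> Dn. j < i})" by (simp add: card_insert_if)
    finally have "int (card K) \<le> 1 + int (card {i \<in> Dn. j < i})" by simp
    also have "\<dots> \<le> cnt (sel c S) (d ! (j - 1))"
      using greedyD[of j] j(1) by (auto simp: K_def rest_def)
    also have "\<dots> \<le> cnt (sel c S) u" using j(1) by (intro cnt_mono) (simp add: K_def)
    finally show ?thesis .
  qed simp
  then show ?thesis using cnt_X[of u] by (simp add: cnt_sel K_def)
qed

text \<open>A descent at \<open>u\<close> needs an unselected \<open>d\<close> equal to
  \<open>u\<close>, so no \<open>c\<close> sits there. Among the ties, one index was accepted with
  \<open>rest\<close> equal to \<open>i + 1\<close>, and the rule then tests precisely slope
  \<open>i\<close>.\<close>

lemma greedy_descent: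
  assumes "cnt X u - cnt d u \<le> int i" "int i < cnt X (u - 1) - cnt d (u - 1)"
  shows "ar X u - ar d u \<le> tang a i u \<or> cnt a (u - 1) \<le> int i"
proof -
  define K where "K = {t \<in> Dn. d ! (t - 1) = u}"
  have fK: "finite K" by (simp add: K_def)
  have "{t \<in> Dn. d ! (t - 1) \<le> u} = {t \<in> Dn. d ! (t - 1) \<le> u - 1} \<union> K"
    by (auto simp: K_def)
  then have cntK: "cnt (sel d Dn) u = cnt (sel d Dn) (u - 1) + int (card K)"
    by (simp add: cnt_sel) (subst card_Un_disjoint, auto simp: K_def)
  have mono: "cnt (sel c S) (u - 1) \<le> cnt (sel c S) u" by (rule cnt_mono) simp
  then have "0 < card K" using assms cntK unfolding cnt_X by linarith
  then obtain t where "t \<in> K" by (metis card_gt_0_iff ex_in_conv)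
  then have ud: "u \<in> set d" by (auto simp: K_def)
  have "cnt (sel c S) u = cnt (sel c S) (u - 1)"
  proof (rule ccontr)
    assume "cnt (sel c S) u \<noteq> cnt (sel c S) (u - 1)"
    then have "cnt (sel c S) (u - 1) < cnt (sel c S) u" using mono by simp
    then obtain x where "x \<in> set (sel c S)" "u - 1 < x" "x \<le> u" by (rule cnt_less_imp_between)
    moreover then have "x = u" by linarith
    ultimately have "u \<in> set (sel c S)" by simp
    then obtain i where "i \<in> S" "u = c ! (i - 1)" using fin by (auto simp: set_sel)
    moreover then have "i - 1 < length c" using S by force
    ultimately have "u \<in> set c" by simp
    then show False using ud disj by blast
  qed
  note cS = this
  \<comment> \<open>A tied index with \<open>r\<close> unselected ties behind it has
    \<open>rest\<close> equal to the difference at \<open>u - 1\<close> minus \<open>r\<close>; this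
    \<open>r\<close> makes that \<open>i + 1\<close>.\<close>
  define r where "r = nat (cnt X (u - 1) - cnt d (u - 1) - int i - 1)"
  have r: "int r = cnt X (u - 1) - cnt d (u - 1) - int i - 1" using assms by (simp add: r_def)
  then have "r < card K" using assms cntK cS unfolding cnt_X by linarith
  then obtain j where j: "j \<in> K" "card {t\<in>K. j < t} = r" using exists_rank[OF fK] by blast
  have jd: "j \<in> {1..length d}" "d ! (j - 1) = u" "j \<notin> D" using j by (auto simp: K_def)
  have "{t \<in> Dn. j < t} = {t \<in> Dn. d ! (t - 1) \<le> u - 1} \<union> {t\<in>K. j < t}"
  proof -
    have "d ! (t - 1) \<le> u - 1 \<or> d ! (t - 1) = u" if "t \<in> Dn" "j < t" for t
      using is_partition_index_mono[OF part(3), of j t] that jd by force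
    moreover have "j < t" if "t \<in> Dn" "d ! (t - 1) \<le> u - 1" for t
      using is_partition_index_mono[OF part(3) _ jd(1), of t] that jd by force
    ultimately show ?thesis by (auto simp: K_def)
  qed
  then have "card {t \<in> Dn. j < t} = card {t \<in> Dn. d ! (t - 1) \<le> u - 1} + r"
    using j(2) by (simp, subst card_Un_disjoint) (auto simp: K_def)
  then have "rest c d S D j = int i + 1"
    using r cS jd(2) unfolding cnt_X rest_def by (simp add: cnt_sel)
  then show ?thesis using greedyD[OF jd(1,2)] jd(3) by auto
qed

text \<open>A descent refused by the rule violates the tangent bound for \<open>g\<close> as well, because \<open>g\<close> has at least
  the area of \<open>X\<close>.\<close>
lemma greedy_minimal_step:
  assumes g: "is_partition g" "length g = length d + length a" "gmaj g d a"
    and below: "\<And>v. v < u \<Longrightarrow> cnt X v \<le> cnt g v"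
    and j: "j \<in> D" "d ! (j - 1) = u"
  shows "cnt X u \<le> cnt g u"
proof (rule ccontr)
  assume less: "\<not> cnt X u \<le> cnt g u"
  have jd: "j \<in> {1..length d}" using j D by blast
  obtain i where i: "int i \<le> cnt g u - cnt d u" "ar g u - ar d u \<le> tang a i u"
    using gmaj_below_tang[OF g(1) part(3) g(2,3)] by metis
  let ?M = "rest c d S D j"
  have M: "int i \<le> ?M - 1" using less rest_ge[OF jd, of u] j(2) i(1) by simp
  then have refused: "?M \<le> cnt a (u - 1)" "tang a (nat (?M - 1)) u < ar X u - ar d u"
    using greedyD[OF jd j(2)] j(1) by auto
  have "int (nat (?M - 1)) \<le> cnt a u" using refused(1) M cnt_mono[of "u - 1" u a] by simp
  \<comment> \<open>The slope supplied by \<open>g\<close> is at most the one tested by the rule, so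
    its bound would imply the refused one.\<close>
  then have "tang a i u \<le> tang a (nat (?M - 1)) u"
    using M by (intro tang_mono part) auto
  moreover have "ar X u \<le> ar g u" using below by (rule ar_mono)
  ultimately show False using i(2) refused(2) by linarith
qed

text \<open>A \<open>d\<close> from \<open>D\<close> in this range would have been processed with
  \<open>rest\<close> above the current slope of \<open>ar a\<close>, and rule (a) would have kept
  it out of \<open>D\<close>.\<close>

lemma greedy_no_gap:
  assumes "x < u" "cnt (sel c S) u \<le> cnt (sel c S) x" "cnt a u < cnt X u - cnt d u"
  shows "cnt X u \<le> cnt X x"
proof (rule ccontr)
  assume "\<not> cnt X u \<le> cnt X x"
  then have "cnt (sel d D) x < cnt (sel d D) u" using assms(2) by simp
  then obtain t where t: "t \<in> set (sel d D)" "x < t" "t \<le> u" by (rule cnt_less_imp_between)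
  then obtain j where j: "j \<in> D" "d ! (j - 1) = t" using fin by (auto simp: set_sel)
  have jd: "j \<in> {1..length d}" using j D by blast
  have "cnt (sel c S) u \<le> cnt (sel c S) t"
    using assms(2) cnt_mono[of x t "sel c S"] t by linarith
  then have "cnt X u - cnt d u \<le> rest c d S D j" using rest_ge[OF jd, of u] j t by simp
  moreover have "cnt a (t - 1) \<le> cnt a u" using t by (intro cnt_mono) simp
  ultimately show False
    using greedyD[OF jd j(2)] j(1) assms(3) cnt_nonneg[of a u] by linarith
qed

end

text \<open>At the least violation \<open>v\<close> the count of \<open>X\<close> jumps, so
  \<open>v\<close> is a selected \<open>c\<close> or a selected \<open>d\<close>. The rule of that
  side alone refutes it, given domination below \<open>v\<close>.\<close>

lemma greedy_minimal:
  assumes part: "is_partition a" "is_partition b" "is_partition c" "is_partition d"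
    and S: "S \<subseteq> {1..length c}" and D: "D \<subseteq> {1..length d}"
    and disj: "\<forall>x\<in>set c. \<forall>y\<in>set d. x \<noteq> y"
    and greedy: "greedy a c d S D" "greedy b d c D S"
    and g: "is_partition g" "length g = length d + length a" "length g = length c + length b"
      "gmaj g d a" "gmaj g c b"
  shows "cnt (sel c S @ sel d D) u \<le> cnt g u"
proof (rule ccontr)
  let ?X = "sel c S @ sel d D"
  assume u: "\<not> cnt ?X u \<le> cnt g u"
  obtain L where L: "L \<le> u" "\<And>x. x \<in> set ?X \<Longrightarrow> L \<le> x"
    using set_lower_bound[of u ?X] by blast
  define V where "V = {v\<in>{L..u}. cnt g v < cnt ?X v}"
  have V: "finite V" "u \<in> V"
    unfolding V_def using L u by (auto intro: finite_subset[of _ "{L..u}"])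
  define v where "v = Min V"
  have v: "v \<in> V" using Min_in[OF V(1)] V(2) unfolding v_def by blast
  have v_le: "v \<le> x" if "x \<in> V" for x using V(1) that by (simp add: v_def)
  have below: "cnt ?X x \<le> cnt g x" if "x < v" for x
  proof (cases "L \<le> x")
    case True
    then show ?thesis using v_le[of x] that v by (force simp: V_def)
  next
    case False
    then have "x < y" if "y \<in> set ?X" for y using L(2)[OF that] False by linarith
    then have "cnt ?X x = 0" by (rule cnt_none)
    then show ?thesis by simp
  qed
  have vX: "cnt g v < cnt ?X v" using v by (simp add: V_def)
  then have "cnt ?X (v - 1) < cnt ?X v"
    using below[of "v - 1"] cnt_mono[of "v - 1" v g] by linarith
  then obtain x where "x \<in> set ?X" "v - 1 < x" "x \<le> v" by (rule cnt_less_imp_between)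
  moreover then have "x = v" by linarith
  ultimately have "v \<in> set ?X" by simp
  then consider j where "j \<in> D" "d ! (j - 1) = v" | j where "j \<in> S" "c ! (j - 1) = v"
    using finite_subset[OF S] finite_subset[OF D] by (auto simp: set_sel)
  then show False
  proof cases
    case 1
    then show ?thesis
      using greedy_minimal_step[OF part(1,3,4) S D disj greedy(1) g(1,2,4) below] vX by force
  next
    case 2
    have disj': "\<forall>x\<in>set d. \<forall>y\<in>set c. x \<noteq> y" using disj by blast
    have "cnt (sel d D @ sel c S) x \<le> cnt g x" if "x < v" for x using below[OF that] by simp
    then show ?thesis
      using greedy_minimal_step[OF part(2,4,3) D S disj' greedy(2) g(1,3,5) _ 2] vX by force
  qed
qed

section \<open>The inequality conditions\<close>

lemma mset_useq: "mset (useq d a) = mset d + mset a"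
proof -
  have "map (\<lambda>i. xs ! (i - 1)) [1..<Suc (length xs)] = xs" for xs :: "int list"
    by (intro nth_equalityI) (simp_all del: upt_Suc)
  moreover have "mset (useq d a) = mset (map (\<lambda>i. d ! (i - 1)) [1..<Suc (length d)])
      + mset (map (\<lambda>i. a ! (i - 1)) [1..<Suc (length a)])"
    by (simp add: useq_def tunion_def mset_map image_mset.compositionality o_def del: upt_Suc mset_upt)
  ultimately show ?thesis by metis
qed

lemma is_partition_useq: "is_partition (useq d a)"
proof -
  have "sorted_wrt (\<lambda>x y. fst y \<le> fst x) (tunion d a)"
  proof -
    have "sorted (map (\<lambda>(v, t, i). (- v, t, i)) (tunion d a))"
      unfolding tunion_def by (rule sorted_sort_key)
    then show ?thesis
      unfolding sorted_map by (rule sorted_wrt_mono_rel[rotated]) (auto simp: less_eq_prod_def)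
  qed
  then show ?thesis by (simp add: useq_def is_partition_def sorted_wrt_map)
qed

lemma cnt_ar_useq:
  "cnt (useq d a) u = cnt d u + cnt a u" "ar (useq d a) u = ar d u + ar a u"
  "length (useq d a) = length d + length a"
proof -
  have m: "mset (useq d a) = mset (d @ a)" by (simp add: mset_useq)
  show "cnt (useq d a) u = cnt d u + cnt a u" "ar (useq d a) u = ar d u + ar a u"
    using cnt_mset[OF m] ar_mset[OF m] by simp_all
  show "length (useq d a) = length d + length a" using mset_eq_length[OF m] by simp
qed

text \<open>The sum of the \<open>N\<close> smallest entries above \<open>x\<close> is the maximum over \<open>u\<close> of a Legendre type expression,
  which turns slice sums into values of \<open>ar e\<close>.\<close>
lemma slice_sum:
  fixes p N :: nat
  assumes part: "is_partition e" and p: "int p = int (length e) - cnt e x" and N: "1 \<le> N" "N \<le> p"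
  defines "t \<equiv> sum_list (drop (p - N) (take p e))"
  shows "x \<le> u \<Longrightarrow> int N * u - (ar e u - ar e x - cnt e x * (u - x)) \<le> t"
    and "\<exists>u\<ge>x. t = int N * u - (ar e u - ar e x - cnt e x * (u - x))"
proof -
  let ?m = "drop (p - N) (take p e)"
  have pl: "p \<le> length e" using p by (simp add: cnt_def)
  have lm: "length ?m = N" using pl N by simp
  have low: "y \<le> x" if "y \<in> set (drop p e)" for y
    using partition_drop_le[OF part that] p by simp
  have high: "x < y" if "y \<in> set (take p e)" for y
    using partition_take_gt[OF part that] p by simp
  have e: "take p e = take (p - N) e @ ?m"
    by (metis append_take_drop_id diff_le_self min.absorb1 take_take)
  have split: "ar e u = ar (take (p - N) e) u + ar ?m u + ar (drop p e) u" for u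
    using ar_split[of e u p] e by (metis ar_simps(3))
  have "ar (take p e) x = 0" using high by (intro ar_none) force
  then have arx: "ar e x = ar (drop p e) x" using ar_split[of e x p] by simp
  have cx: "cnt e x = int (length e - p)" using p pl by linarith
  have dr: "ar (drop p e) u = ar e x + cnt e x * (u - x)" if "x \<le> u" for u
    using ar_all[of "drop p e" u] ar_all[of "drop p e" x] low that arx cx
    by (force simp: algebra_simps)
  show "int N * u - (ar e u - ar e x - cnt e x * (u - x)) \<le> t" if "x \<le> u"
    using split[of u] dr[OF that] ar_nonneg[of "take (p - N) e" u] ar_ge[of ?m u] lm
    by (simp add: t_def)
  \<comment> \<open>The maximum is attained at the largest entry of the slice: all entries before it
    are at least \<open>u\<close> and add no area.\<close>
  define u where "u = e ! (p - N)"
  have pN: "p - N < length e" using pl N by simp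
  have um: "?m \<noteq> []" "?m ! 0 = u" using lm N pN by (auto simp: u_def)
  then have "u \<in> set ?m" using nth_mem[of 0 ?m] by simp
  then have "x < u" using high[of u] in_set_dropD by fast
  moreover have "t = int N * u - (ar e u - ar e x - cnt e x * (u - x))" if "x \<le> u"
  proof -
    have "y \<le> u" if y: "y \<in> set ?m" for y
    proof -
      obtain i where i: "i < length ?m" "?m ! i = y"
        using iffD1[OF in_set_conv_nth y] by (elim exE conjE)
      then have "i < N" "y = e ! (p - N + i)" using lm pl by (simp_all add: nth_drop)
      then show ?thesis
        using pl N is_partition_nthD[OF part, of "p - N" "p - N + i"] by (simp add: u_def)
    qed
    then have "ar ?m u = int N * u - t" using ar_all[of ?m u] lm by (simp add: t_def)
    moreover have "ar (take (p - N) e) u = 0"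
    proof (rule ar_none)
      fix y assume "y \<in> set (take (p - N) e)"
      then obtain i where "i < p - N" "y = e ! i" by (auto simp: in_set_conv_nth)
      then show "u \<le> y" using pN is_partition_nthD[OF part, of i "p - N"] by (simp add: u_def)
    qed
    ultimately show ?thesis using split[of u] dr[OF that] by simp
  qed
  ultimately show "\<exists>u\<ge>x. t = int N * u - (ar e u - ar e x - cnt e x * (u - x))"
    by (intro exI[of _ u]) auto
qed

section \<open>The partial sums in the conditions as slices and areas\<close>

lemma ar_filter: "ar xs u = cnt xs u * u - sum_list (filter (\<lambda>x. x \<le> u) xs)"
  by (induction xs) (auto simp: algebra_simps)

lemma partition_filter_le:
  assumes "is_partition xs"
  shows "filter (\<lambda>x. x \<le> u) xs = drop (length xs - nat (cnt xs u)) xs"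
proof -
  define k where "k = length xs - nat (cnt xs u)"
  have k: "int k = int (length xs) - cnt xs u"
    using cnt_le_length[of xs u] cnt_nonneg[of xs u] unfolding k_def by linarith
  have "\<not> x \<le> u" if "x \<in> set (take k xs)" for x
    using partition_take_gt[OF assms that, of u] k by linarith
  then have "filter (\<lambda>x. x \<le> u) (take k xs) = []"
    by (simp add: filter_empty_conv)
  moreover have "x \<le> u" if "x \<in> set (drop k xs)" for x
    using partition_drop_le[OF assms that, of u] k by linarith
  then have "filter (\<lambda>x. x \<le> u) (drop k xs) = drop k xs"
    by (simp add: filter_id_conv)
  moreover have "filter (\<lambda>x. x \<le> u) xs = filter (\<lambda>x. x \<le> u) (take k xs @ drop k xs)"
    by simp
  ultimately show ?thesis by (simp only: filter_append append_Nil k_def)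
qed

text \<open>A slice longer than the available prefix starts at a nonpositive index, where the
  default entry is infinite. In the conditions this turns \<open>N \<le> p\<close> into a
  requirement.\<close>

lemma sumE_slice:
  assumes "1 \<le> N" "p \<le> length xs"
  shows "sumE xs (int p - int N + 1) (int p)
    = (if N \<le> p then ereal (sum_list (drop (p - N) (take p xs))) else \<infinity>)"
proof (cases "N \<le> p")
  case True
  then show ?thesis using sumE_eq[of "p - N" p xs] assms by (simp add: of_nat_diff)
next
  case False
  have "sumE xs (int p - int N + 1) (int p) = \<infinity>"
    unfolding sumE_def sum_Pinfty
    using False assms by (intro conjI bexI[of _ "int p - int N + 1"]) (auto simp: E_def)
  then show ?thesis using False by simp
qed

lemma card_index_le: "card {i\<in>{1..length xs}. xs ! (i - 1) \<le> u} = nat (cnt xs u)"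
  using cnt_sel[of "{1..length xs}" xs u] by (simp add: sel_all del: One_nat_def)

lemma card_index_gt: "int (card {i\<in>{1..length xs}. u < xs ! (i - 1)}) = int (length xs) - cnt xs u"
proof -
  let ?L = "{i\<in>{1..length xs}. xs ! (i - 1) \<le> u}"
  have "{i\<in>{1..length xs}. u < xs ! (i - 1)} = {1..length xs} - ?L" by auto
  moreover have "card ({1..length xs} - ?L) = card {1..length xs} - card ?L"
    by (rule card_Diff_subset) auto
  ultimately have "card {i\<in>{1..length xs}. u < xs ! (i - 1)} = length xs - nat (cnt xs u)"
    unfolding card_index_le by simp
  then show ?thesis using cnt_le_length[of xs u] cnt_nonneg[of xs u] by linarith
qed

lemma index_gt_iff:
  assumes "is_partition d" "i \<in> {1..length d}"
  shows "int (length d) - cnt d u + 1 \<le> int i \<longleftrightarrow> d ! (i - 1) \<le> u"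
proof -
  have "i - 1 < length d" "int (i - 1) = int i - 1" using assms(2) by auto
  then show ?thesis using partition_nth_le_iff[OF assms(1), of "i - 1" u] by auto
qed

text \<open>With \<open>x\<close> the selected entry, \<open>z + m\<close> is the number
  \<open>p\<close> of entries of \<open>e\<close> above \<open>x\<close>, and \<open>z + t\<close>
  is \<open>p - N + 1\<close>; so the left side sums the \<open>N\<close> smallest entries of
  \<open>e\<close> above \<open>x\<close>. Expanding the areas at \<open>x\<close> gives the right
  side. Here \<open>y\<close> counts from 0.\<close>

lemma cond_i_iff_slices:
  assumes part: "is_partition a" "is_partition d"
    and S: "S \<subseteq> {1..length c}" and D: "D \<subseteq> {1..length d}"
    and disj: "\<forall>x\<in>set c. \<forall>y\<in>set d. x \<noteq> y"
  defines "X \<equiv> sel c S @ sel d D" and "e \<equiv> useq d a" and "cS \<equiv> rev (sort (sel c S))"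
  shows "cond_i a c d S D \<longleftrightarrow> (\<forall>y<length cS. \<forall>N p. 1 \<le> N \<longrightarrow>
    int N = int (length cS) - int y - cnt (sel d (compl_in d D)) (cS ! y) - cnt a (cS ! y) \<longrightarrow>
    int p = int (length e) - cnt e (cS ! y) \<longrightarrow>
    N \<le> p \<and> sum_list (drop (p - N) (take p e))
      \<le> int N * cS ! y - (ar X (cS ! y) - ar e (cS ! y)))"
    (is "_ \<longleftrightarrow> (\<forall>y<_. ?C y)")
proof -
  let ?Dn = "compl_in d D"
  have fS: "finite S" using S finite_subset by blast
  have len: "length cS = card S" by (simp add: cS_def length_sel)
  have partS: "is_partition cS" unfolding cS_def by (rule is_partition_sorted)
  have mS: "mset cS = mset (sel c S)" by (simp add: cS_def)
  have setS: "set cS = (\<lambda>i. c ! (i - 1)) ` S" using fS by (simp add: cS_def set_sel)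
  let ?G = "\<lambda>y. let cy = cS ! (y - 1);
                my = int (card {i\<in>{1..length a}. a ! (i - 1) > cy});
                ty = int (length a) - (int (card S) - int y)
                  + int (card {i\<in>?Dn. d ! (i - 1) < cy});
                zy = int (card {i\<in>{1..length d}. d ! (i - 1) > cy})
            in ty \<le> my \<longrightarrow>
               sumE e (zy + ty) (zy + my)
                 \<le> sumE cS (int y) (int (card S))
                    - ereal (\<Sum>i\<in>{i\<in>?Dn. int i \<ge> zy + 1}. d ! (i - 1))
                    - sumE a (my + 1) (int (length a))"
  have main: "?G (Suc y) \<longleftrightarrow> ?C y"
    if y: "y < length cS" for y
  proof -
    define x where "x = cS ! y"
    have xc: "x \<in> set c"
    proof -
      have "x \<in> set cS" using y by (simp add: x_def)
      then obtain i where "i \<in> S" "x = c ! (i - 1)" using setS by auto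
      moreover then have "i - 1 < length c" using S by force
      ultimately show ?thesis by simp
    qed
    have my: "int (card {i\<in>{1..length a}. a ! (i - 1) > x}) = int (length a) - cnt a x"
      by (rule card_index_gt)
    have zy: "int (card {i\<in>{1..length d}. d ! (i - 1) > x}) = int (length d) - cnt d x"
      by (rule card_index_gt)
    \<comment> \<open>Disjointness of values lets the strict comparison in the definition of
      \<open>t\<close> agree with the weak one in \<open>cnt\<close>.\<close>
    have "d ! (i - 1) \<noteq> x" if "i \<in> ?Dn" for i
    proof -
      have "d ! (i - 1) \<in> set d" using that by (intro nth_mem) auto
      then show ?thesis using xc disj by blast
    qed
    then have "{i\<in>?Dn. d ! (i - 1) < x} = {i\<in>?Dn. d ! (i - 1) \<le> x}"
      by (intro Collect_cong) (auto simp: order.order_iff_strict)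
    then have dn: "int (card {i\<in>?Dn. d ! (i - 1) < x}) = cnt (sel d ?Dn) x"
      by (simp add: cnt_sel)
    have "{i\<in>?Dn. int i \<ge> int (length d) - cnt d x + 1} = {i\<in>?Dn. d ! (i - 1) \<le> x}"
      using index_gt_iff[OF part(2)] by blast
    then have sd: "(\<Sum>i\<in>{i\<in>?Dn. int i \<ge> int (length d) - cnt d x + 1}. d ! (i - 1))
        = sum_list (filter (\<lambda>z. z \<le> x) (sel d ?Dn))"
      by (simp add: sum_list_sel_filter)
    have sc: "sumE cS (int (Suc y)) (int (card S)) = ereal (sum_list (drop y cS))"
      using sumE_eq[of y "length cS" cS] y len by (simp add: add.commute)
    have "int (length a - nat (cnt a x)) = int (length a) - cnt a x"
      using cnt_le_length[of a x] cnt_nonneg[of a x] by linarith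
    then have sa: "sumE a (int (length a) - cnt a x + 1) (int (length a))
        = ereal (sum_list (filter (\<lambda>z. z \<le> x) a))"
      using sumE_eq[of "length a - nat (cnt a x)" "length a" a] partition_filter_le[OF part(1), of x]
      by simp
    have arS: "ar (sel c S) x = (int (length cS) - int y) * x - sum_list (drop y cS)"
    proof -
      have "ar (take y cS) x = 0"
      proof (rule ar_none)
        fix z assume "z \<in> set (take y cS)"
        then obtain i where "i < y" "z = cS ! i" by (auto simp: in_set_conv_nth)
        then show "x \<le> z" using y is_partition_nthD[OF partS, of i y] by (simp add: x_def)
      qed
      moreover have "z \<le> x" if "z \<in> set (drop y cS)" for z
      proof -
        obtain i where "i < length cS - y" "z = cS ! (y + i)" using \<open>z \<in> _\<close> by (auto simp: in_set_conv_nth)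
        then show ?thesis using is_partition_nthD[OF partS, of y "y + i"] by (simp add: x_def)
      qed
      then have "ar (drop y cS) x = int (length cS - y) * x - sum_list (drop y cS)"
        using ar_all[of "drop y cS" x] by simp
      ultimately show ?thesis using ar_split[of cS x y] ar_mset[OF mS] y by (simp add: of_nat_diff)
    qed
    have "ar X x - ar e x = ar (sel c S) x - ar (sel d ?Dn) x - ar a x"
      using cnt_ar_compl(2)[OF D, of x] by (simp add: X_def e_def cnt_ar_useq)
    then have R: "ar X x - ar e x = (int (length cS) - int y - cnt (sel d ?Dn) x - cnt a x) * x
        - (sum_list (drop y cS) - sum_list (filter (\<lambda>z. z \<le> x) (sel d ?Dn))
          - sum_list (filter (\<lambda>z. z \<le> x) a))"
      using arS ar_filter[of "sel d ?Dn" x] ar_filter[of a x] by (simp add: algebra_simps)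
    define NI where "NI = int (length cS) - int y - cnt (sel d ?Dn) x - cnt a x"
    define p where "p = nat (int (length e) - cnt e x)"
    have p: "int p = int (length e) - cnt e x" "p \<le> length e"
      using cnt_le_length[of e x] cnt_nonneg[of e x] unfolding p_def by linarith+
    have pz: "int (length d) - cnt d x + (int (length a) - cnt a x) = int p"
      using p by (simp add: e_def cnt_ar_useq)
    have tz: "int (length d) - cnt d x + (int (length a) - (int (card S) - int (Suc y)) + cnt (sel d ?Dn) x)
        = int p - NI + 1"
      using pz len by (simp add: NI_def)
    have tm: "int (length a) - (int (card S) - int (Suc y)) + cnt (sel d ?Dn) x \<le> int (length a) - cnt a x
        \<longleftrightarrow> 1 \<le> NI" using len by (auto simp: NI_def)
    show ?thesis
      unfolding Let_def diff_Suc_1 x_def[symmetric] my zy dn sd sc sa tm pz tz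
    proof (cases "1 \<le> NI")
      case True
      define N where "N = nat NI"
      have N: "int N = NI" "1 \<le> N" using True unfolding N_def by linarith+
      have "(sumE e (int p - int N + 1) (int p) \<le> ereal (sum_list (drop y cS))
          - ereal (sum_list (filter (\<lambda>z. z \<le> x) (sel d ?Dn))) - ereal (sum_list (filter (\<lambda>z. z \<le> x) a)))
        \<longleftrightarrow> N \<le> p \<and> sum_list (drop (p - N) (take p e)) \<le> int N * x - (ar X x - ar e x)"
        unfolding sumE_slice[OF N(2) p(2)] R NI_def[symmetric]
        unfolding N(1) by (simp flip: of_int_diff) (intro impI iffI; linarith)
      moreover have "(\<forall>N' p'. 1 \<le> N' \<longrightarrow> int N' = NI \<longrightarrow> int p' = int (length e) - cnt e x \<longrightarrow> Q N' p')
        \<longleftrightarrow> Q N p" for Q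
        using N p(1) by (metis of_nat_eq_iff)
      ultimately show "(1 \<le> NI \<longrightarrow> sumE e (int p - NI + 1) (int p) \<le> ereal (sum_list (drop y cS))
          - ereal (sum_list (filter (\<lambda>z. z \<le> x) (sel d ?Dn))) - ereal (sum_list (filter (\<lambda>z. z \<le> x) a)))
        \<longleftrightarrow> (\<forall>N p. 1 \<le> N \<longrightarrow> int N = int (length cS) - int y - cnt (sel d ?Dn) x - cnt a x \<longrightarrow>
          int p = int (length e) - cnt e x \<longrightarrow>
          N \<le> p \<and> sum_list (drop (p - N) (take p e)) \<le> int N * x - (ar X x - ar e x))"
        using True N(1) unfolding NI_def[symmetric] by simp
    qed (auto simp: NI_def)
  qed
  have "cond_i a c d S D \<longleftrightarrow> (\<forall>y\<in>{1..card S}. ?G y)"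
    by (simp only: cond_i_def Let_def cS_def e_def sel_def)
  also have "\<dots> \<longleftrightarrow> (\<forall>y<card S. ?G (Suc y))"
    unfolding image_Suc_lessThan[symmetric] by auto
  also have "\<dots> \<longleftrightarrow> (\<forall>y<length cS. ?C y)"
    unfolding len using main[unfolded len] by (intro all_cong) blast
  finally show ?thesis .
qed

text \<open>Far to the right the slope of \<open>ar\<close> is the length, so a longer list
  eventually has larger area; \<open>k\<close> is a distance at which this has happened.\<close>

lemma area_le_imp_length_le:
  assumes area: "\<And>u. ar xs u \<le> ar ys u"
  shows "length xs \<le> length ys"
proof (rule ccontr)
  assume big: "\<not> length xs \<le> length ys"
  obtain U where "\<And>z. z \<in> set (xs @ ys) \<Longrightarrow> z \<le> U" using set_upper_bound[of 0] by blast
  then have U: "\<And>z. z \<in> set xs \<Longrightarrow> z \<le> U" "\<And>z. z \<in> set ys \<Longrightarrow> z \<le> U" by auto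
  define k where "k = ar ys U + 1"
  have k: "0 < k" using ar_nonneg[of ys U] by (simp add: k_def)
  have lin: "ar zs (U + k) = ar zs U + int (length zs) * k" if "\<And>z. z \<in> set zs \<Longrightarrow> z \<le> U" for zs
    using ar_all[of zs "U + k"] ar_all[of zs U] that k by (force simp: algebra_simps)
  have "(int (length ys) + 1) * k \<le> int (length xs) * k" using big k by (intro mult_right_mono) auto
  then show False
    using area[of "U + k"] lin[of xs] lin[of ys] U ar_nonneg[of xs U]
    by (simp add: k_def distrib_right)
qed

text \<open>By \<open>slice_sum\<close>, the condition at \<open>x\<close> says that to the right of
  \<open>x\<close> the line through \<open>ar X x\<close> of slope \<open>N + cnt e x\<close> stays
  below \<open>ar e\<close>. Convexity of \<open>ar X\<close> gives one direction. Conversely, where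
  \<open>ar X\<close> first overtakes, it still follows the line starting at the last selected
  \<open>c\<close>.\<close>

lemma cond_i_iff:
  assumes part: "is_partition a" "is_partition c" "is_partition d"
    and S: "S \<subseteq> {1..length c}" and D: "D \<subseteq> {1..length d}"
    and disj: "\<forall>x\<in>set c. \<forall>y\<in>set d. x \<noteq> y"
    and greedy: "greedy a c d S D"
  shows "cond_i a c d S D \<longleftrightarrow> (\<forall>u. ar (sel c S @ sel d D) u \<le> ar d u + ar a u)"
proof -
  let ?Dn = "compl_in d D"
  define X where "X = sel c S @ sel d D"
  define e where "e = useq d a"
  define cS where "cS = rev (sort (sel c S))"
  have e: "is_partition e" "\<And>u. cnt e u = cnt d u + cnt a u" "\<And>u. ar e u = ar d u + ar a u"
    by (simp_all add: e_def is_partition_useq cnt_ar_useq)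
  have partS: "is_partition cS" unfolding cS_def by (rule is_partition_sorted)
  have cntS: "cnt cS u = cnt (sel c S) u" for u by (rule cnt_mset) (simp add: cS_def)
  have Xe: "cnt X u - cnt e u = cnt cS u - cnt (sel d ?Dn) u - cnt a u" for u
    using cnt_ar_compl(1)[OF D, of u] by (simp add: X_def e cntS)
  note slices = cond_i_iff_slices[OF part(1,3) S D disj, folded X_def e_def cS_def]
  show ?thesis
    unfolding slices X_def[symmetric] e(3)[symmetric]
  proof (intro iffI allI impI)
    fix y N p
    assume area: "\<forall>u. ar X u \<le> ar e u" and y: "y < length cS" and N: "1 \<le> N"
      "int N = int (length cS) - int y - cnt (sel d ?Dn) (cS ! y) - cnt a (cS ! y)"
      and p: "int p = int (length e) - cnt e (cS ! y)"
    define x where "x = cS ! y"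
    have "int (length cS) - int y \<le> cnt cS x" using partition_nth_le_iff[OF partS y, of x] by (simp add: x_def)
    then have NX: "int N + cnt e x \<le> cnt X x" using N(2) Xe[of x] by (simp add: x_def)
    have "cnt X x \<le> int (length e)"
      using area_le_imp_length_le[of X e] area cnt_le_length[of X x] by fastforce
    then have Np: "N \<le> p" using NX p by (simp add: x_def)
    obtain u where u: "x \<le> u" "sum_list (drop (p - N) (take p e))
        = int N * u - (ar e u - ar e x - cnt e x * (u - x))"
      using slice_sum(2)[OF e(1) p[folded x_def] N(1) Np] by blast
    have "(int N + cnt e x) * (u - x) \<le> cnt X x * (u - x)"
      using NX u(1) by (intro mult_right_mono) auto
    then have "ar X x + (int N + cnt e x) * (u - x) \<le> ar e u"
      using ar_convex[OF u(1), of X] spec[OF area, of u] by linarith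
    then show "N \<le> p \<and> sum_list (drop (p - N) (take p e))
        \<le> int N * cS ! y - (ar X (cS ! y) - ar e (cS ! y))"
      using Np u(2) by (simp add: x_def algebra_simps)
  next
    fix u0
    assume slice: "\<forall>y<length cS. \<forall>N p. 1 \<le> N \<longrightarrow>
      int N = int (length cS) - int y - cnt (sel d ?Dn) (cS ! y) - cnt a (cS ! y) \<longrightarrow>
      int p = int (length e) - cnt e (cS ! y) \<longrightarrow>
      N \<le> p \<and> sum_list (drop (p - N) (take p e))
        \<le> int N * cS ! y - (ar X (cS ! y) - ar e (cS ! y))"
    show "ar X u0 \<le> ar e u0"
    proof (rule ccontr)
      assume "\<not> ar X u0 \<le> ar e u0"
      obtain L where L: "L \<le> u0" "\<And>z. z \<in> set X \<Longrightarrow> L \<le> z"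
        using set_lower_bound[of u0 X] by blast
      have aL: "ar X v \<le> ar e v" if "v \<le> L" for v
      proof -
        have "ar X v = 0" using L(2) that by (intro ar_none) force
        then show ?thesis using ar_nonneg by simp
      qed
      obtain w where w: "ar X w \<le> ar e w" "\<not> ar X (w + 1) \<le> ar e (w + 1)"
      proof (rule ccontr)
        assume "\<not> thesis"
        then have step: "ar X v \<le> ar e v \<Longrightarrow> ar X (v + 1) \<le> ar e (v + 1)" for v using that by blast
        have "ar X v \<le> ar e v" if "L \<le> v" for v
          using that by (induction v rule: int_ge_induct) (auto simp: aL step)
        then have "ar X u0 \<le> ar e u0" using L(1) by blast
        then show False using \<open>\<not> ar X u0 \<le> ar e u0\<close> by simp
      qed
      have wX: "cnt e w < cnt X w" using w by (simp add: ar_step)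
      have pos: "cnt (sel d ?Dn) w + cnt a w < cnt cS w" using wX Xe[of w] by simp
      \<comment> \<open>This is the first index of the largest selected \<open>c\<close> not above
        \<open>w\<close>; \<open>pos\<close> guarantees that one exists. Taking the first among ties
        makes \<open>N\<close> equal to \<open>cnt X x - cnt e x\<close>.\<close>
      define y where "y = nat (int (length cS) - cnt cS w)"
      have y: "int y = int (length cS) - cnt cS w" "y < length cS"
        using cnt_le_length[of cS w] pos cnt_nonneg[of "sel d ?Dn" w] cnt_nonneg[of a w]
        unfolding y_def by linarith+
      define x where "x = cS ! y"
      have xw: "x \<le> w" using partition_nth_le_iff[OF partS y(2), of w] y(1) by (simp add: x_def)
      have "int (length cS) - int y \<le> cnt cS x"
        using partition_nth_le_iff[OF partS y(2), of x] by (simp add: x_def)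
      then have cx: "cnt cS x = cnt cS w" using y(1) cnt_mono[OF xw, of cS] by simp
      define N where "N = nat (cnt cS w - cnt (sel d ?Dn) x - cnt a x)"
      define p where "p = nat (int (length e) - cnt e x)"
      have N: "int N = cnt cS w - cnt (sel d ?Dn) x - cnt a x" "1 \<le> N"
        using pos cnt_mono[OF xw, of "sel d ?Dn"] cnt_mono[OF xw, of a] unfolding N_def by linarith+
      have p: "int p = int (length e) - cnt e x" using cnt_le_length[of e x] by (simp add: p_def)
      have sl: "N \<le> p" "sum_list (drop (p - N) (take p e)) \<le> int N * x - (ar X x - ar e x)"
        using slice y N p by (auto simp: x_def)
      have lower: "int N * (w + 1) - (ar e (w + 1) - ar e x - cnt e x * (w + 1 - x))
          \<le> sum_list (drop (p - N) (take p e))"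
        using slice_sum(1)[OF e(1) p N(2) sl(1)] xw by simp
      have NX: "int N = cnt X x - cnt e x" using N(1) Xe[of x] cx by simp
      have "cnt X w \<le> cnt X x"
      proof (cases "x = w")
        case False
        have "cnt a w < cnt X w - cnt d w" using wX e(2)[of w] by simp
        then show ?thesis unfolding X_def
          using False xw cx cntS by (intro greedy_no_gap[OF part S D disj greedy]) (auto simp: X_def)
      qed simp
      note le = this
      \<comment> \<open>No entry of \<open>X\<close> lies above \<open>x\<close> and up to
        \<open>w\<close>, so \<open>ar X\<close> grows no faster than the line of slope
        \<open>cnt X x\<close>, which the slice inequality keeps below \<open>ar e\<close> at
        \<open>w + 1\<close>.\<close>
      have "- ar X x + (- cnt X x) * (w + 1 - x) \<le> - ar X (w + 1)"
      proof (rule step_growth)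
        show "x \<le> w + 1" using xw by simp
        show "- ar X v + (- cnt X x) \<le> - ar X (v + 1)" if "v < w + 1" for v
          using le cnt_mono[of v w X] that by (simp add: ar_step)
      qed
      with lower show False using sl(2) w(2) NX by (simp add: algebra_simps)
    qed
  qed
qed

section \<open>The construction follows the selection rule\<close>

lemma takeWhile_sorted_key:
  assumes "sorted (map f ys)" "inj_on f (set ys)" "t \<in> set ys"
  shows "takeWhile (\<lambda>v. v \<noteq> t) ys = filter (\<lambda>v. f v < f t) ys"
  using assms
proof (induction ys)
  case (Cons y ys)
  show ?case
  proof (cases "y = t")
    case True
    then have "\<not> f v < f t" if "v \<in> set ys" for v using Cons.prems(1) that by auto
    then show ?thesis using True by (simp add: filter_empty_conv)
  next
    case False
    then have t: "t \<in> set ys" using Cons.prems(3) by simp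
    then have "f y \<le> f t" "f y \<noteq> f t" using Cons.prems False by (auto simp: inj_on_def)
    moreover have "takeWhile (\<lambda>v. v \<noteq> t) ys = filter (\<lambda>v. f v < f t) ys"
      using Cons.IH Cons.prems t by simp
    ultimately show ?thesis using False by simp
  qed
qed simp

lemma length_takeWhile_sort_key:
  assumes "inj_on f (set xs)" "t \<in> set xs"
  shows "length (takeWhile (\<lambda>v. v \<noteq> t) (sort_key f xs)) = length (filter (\<lambda>v. f v < f t) xs)"
  using assms by (subst takeWhile_sorted_key[where f = f]) (simp_all add: filter_sort)

lemma length_filter_index:
  "length (filter P (map f [1..<Suc n])) = card {i\<in>{1..n}. P (f i)}"
proof -
  let ?l = "filter (P \<circ> f) [1..<Suc n]"
  have "card (set ?l) = length ?l" by (rule distinct_card) (simp del: upt_Suc)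
  moreover have "set ?l = {i\<in>{1..n}. P (f i)}" by auto
  ultimately show ?thesis by (simp add: filter_map del: upt_Suc)
qed

lemma card_index_gt_above:
  assumes "is_partition d" "j \<in> {1..length d}" "x < d ! (j - 1)"
  shows "int (card {i\<in>{1..length d}. j < i \<and> x < d ! (i - 1)}) = int (length d) - cnt d x - int j"
    and "int j \<le> int (length d) - cnt d x"
proof -
  show j: "int j \<le> int (length d) - cnt d x"
    using index_gt_iff[OF assms(1,2), of x] assms(3) by linarith
  define k where "k = nat (int (length d) - cnt d x)"
  have k: "int k = int (length d) - cnt d x"
    using cnt_le_length[of d x] by (simp add: k_def)
  have "{i\<in>{1..length d}. j < i \<and> x < d ! (i - 1)} = {Suc j..k}"
  proof (intro set_eqI iffI)
    fix i assume "i \<in> {i\<in>{1..length d}. j < i \<and> x < d ! (i - 1)}"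
    then show "i \<in> {Suc j..k}" using index_gt_iff[OF assms(1), of i x] k by auto
  next
    fix i assume "i \<in> {Suc j..k}"
    then have "j < i" "i \<le> k" by auto
    moreover from this have "i \<le> length d" using k cnt_nonneg[of d x] by linarith
    ultimately show "i \<in> {i\<in>{1..length d}. j < i \<and> x < d ! (i - 1)}"
      using index_gt_iff[OF assms(1), of i x] k assms(2) by auto
  qed
  then show "int (card {i\<in>{1..length d}. j < i \<and> x < d ! (i - 1)})
    = int (length d) - cnt d x - int j" using k j by simp
qed

text \<open>The left side counts the entries of \<open>e\<close> above \<open>x\<close> that come
  after the given \<open>d\<close>: the later \<open>d\<close>'s above \<open>x\<close> and the
  \<open>a\<close>'s strictly in between. An equal \<open>a\<close> is left out because ties place
  it earlier.\<close>

lemma among_smallest_iff: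
  assumes part: "is_partition d" and j: "j \<in> {1..length d}" and x: "x < d ! (j - 1)"
  shows "among_smallest d a j N x \<longleftrightarrow>
    int (length d) - cnt d x - int j + cnt a (d ! (j - 1) - 1) - cnt a x < N"
proof -
  let ?u = "d ! (j - 1)"
  let ?f = "\<lambda>(v, t, i). (- v, t, i) :: int \<times> nat \<times> nat"
  let ?A = "map (\<lambda>i. (a ! (i - 1), 0::nat, i)) [1..<Suc (length a)]"
  let ?D = "map (\<lambda>i. (d ! (i - 1), 1::nat, i)) [1..<Suc (length d)]"
  have U: "tunion d a = sort_key ?f (?A @ ?D)" by (simp add: tunion_def)
  have inj: "inj_on ?f (set (?A @ ?D))" by (auto simp: inj_on_def)
  have mem: "(?u, 1, j) \<in> set (?A @ ?D)"
    using j by (auto simp del: upt_Suc One_nat_def intro!: image_eqI[of _ _ j])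
  have lt: "?f (a ! (i - 1), 0, i) < ?f (?u, 1, j) \<longleftrightarrow> ?u - 1 < a ! (i - 1)" for i
    by (auto simp: less_prod_simp)
  have lt_d: "?f (d ! (i - 1), 1, i) < ?f (?u, 1, j) \<longleftrightarrow> i < j" if "i \<in> {1..length d}" for i
    using is_partition_index_mono[OF part _ j, of i] is_partition_index_mono[OF part _ that, of j]
    by (cases i j rule: linorder_cases) (auto simp: less_prod_simp)
  have "{i\<in>{1..length d}. ?f (d ! (i - 1), 1, i) < ?f (?u, 1, j)} = {i\<in>{1..length d}. i < j}"
    by (intro Collect_cong conj_cong refl lt_d)
  also have "\<dots> = {1..<j}" using j by auto
  finally have "{i\<in>{1..length d}. ?f (d ! (i - 1), 1, i) < ?f (?u, 1, j)} = {1..<j}" .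
  then have "length (takeWhile (\<lambda>v. v \<noteq> (?u, 1, j)) (tunion d a))
      = card {i\<in>{1..length a}. ?u - 1 < a ! (i - 1)} + (j - 1)"
    unfolding U length_takeWhile_sort_key[OF inj mem] filter_append length_append
      length_filter_index lt by simp
  then have pos: "int (Suc (length (takeWhile (\<lambda>v. v \<noteq> (?u, 1, j)) (tunion d a))))
      = int (length a) - cnt a (?u - 1) + int j"
    using card_index_gt[of a "?u - 1"] j by simp
  have "length (filter (\<lambda>v. fst v > x) (tunion d a)) = length (filter (\<lambda>v. \<not> v \<le> x) (useq d a))"
    by (simp add: useq_def filter_map o_def not_le)
  also have "int \<dots> = int (length (useq d a)) - cnt (useq d a) x"
    using sum_length_filter_compl[of "\<lambda>v. v \<le> x" "useq d a"] by (simp add: cnt_def)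
  finally have P: "int (length (filter (\<lambda>v. fst v > x) (tunion d a)))
      = int (length d) + int (length a) - cnt d x - cnt a x"
    by (simp add: cnt_ar_useq)
  have "cnt a x \<le> cnt a (?u - 1)" using x by (intro cnt_mono) simp
  then have le: "Suc (length (takeWhile (\<lambda>v. v \<noteq> (?u, 1, j)) (tunion d a)))
      \<le> length (filter (\<lambda>v. fst v > x) (tunion d a))"
    unfolding of_nat_le_iff[symmetric, where ?'a = int] pos P
    using card_index_gt_above(2)[OF part j x] by linarith
  show ?thesis
    unfolding among_smallest_def Let_def pos P
    by (simp only: le x simp_thms) linarith
qed

lemma ar_sel: "finite I \<Longrightarrow> ar (sel xs I) u = (\<Sum>i\<in>I. max 0 (u - xs ! (i - 1)))"
  by (simp add: ar_def sel_def o_def sum_list_distinct_conv_sum_set)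

lemma ar_sel_subset:
  assumes "finite I" "J \<subseteq> I" "\<And>i. i \<in> J \<Longrightarrow> xs ! (i - 1) \<le> u"
    "\<And>i. i \<in> I - J \<Longrightarrow> u \<le> xs ! (i - 1)"
  shows "ar (sel xs I) u = int (card J) * u - (\<Sum>i\<in>J. xs ! (i - 1))"
proof -
  have "max 0 (u - xs ! (i - 1)) = 0" if "i \<in> I - J" for i using assms(4)[OF that] by simp
  then have "(\<Sum>i\<in>I. max 0 (u - xs ! (i - 1))) = (\<Sum>i\<in>J. max 0 (u - xs ! (i - 1)))"
    using assms(1,2) by (intro sum.mono_neutral_right) auto
  also have "\<dots> = (\<Sum>i\<in>J. u - xs ! (i - 1))"
    using assms(3) by (intro sum.cong) (auto simp: max_def)
  finally show ?thesis using assms(1) by (simp add: ar_sel sum_subtractf)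
qed

text \<open>Rule (a) reads a position in \<open>e\<close> and so counts all \<open>d\<close>'s
  between \<open>x\<close> and the current one, whereas \<open>greedy\<close> counts only the
  unselected ones. Induction over the indices processed earlier reconciles them: when the slope test
  succeeds, every \<open>d\<close> in between was itself kept out of \<open>D\<close>.\<close>

lemma greedyI:
  assumes part: "is_partition a" "is_partition c" "is_partition d"
    and S: "S \<subseteq> {1..length c}" and D: "D \<subseteq> {1..length d}"
    and disj: "\<forall>x\<in>set c. \<forall>y\<in>set d. x \<noteq> y"
    and proc: "\<And>j. j \<in> {1..length d} \<Longrightarrow> j \<notin> D \<longleftrightarrow>
      proc a c d {i\<in>S. c ! (i - 1) < d ! (j - 1)} {i\<in>compl_in d D. j < i} j"
  shows "greedy a c d S D"
  unfolding greedy_def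
proof
  let ?Dn = "compl_in d D"
  have fS: "finite S" using S finite_subset by blast
  have d_mono: "d ! (j - 1) \<le> d ! (i - 1)" if "i \<le> j" "j \<in> {1..length d}" for i j
    using is_partition_index_mono[OF part(3) that] .
  have ne: "c ! (i - 1) \<noteq> d ! (j - 1)" if "i \<in> S" "j \<in> {1..length d}" for i j
  proof -
    have "i - 1 < length c" "j - 1 < length d" using that S by force+
    then show ?thesis using disj by auto
  qed
  fix j assume "j \<in> {1..length d}"
  then show "j \<notin> D \<longleftrightarrow> 1 \<le> rest c d S D j \<and>
     (cnt a (d ! (j - 1) - 1) < rest c d S D j \<or>
      ar (sel c S) (d ! (j - 1)) - ar (sel d ?Dn) (d ! (j - 1))
        \<le> tang a (nat (rest c d S D j - 1)) (d ! (j - 1)))"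
  proof (induction "length d - j" arbitrary: j rule: less_induct)
    case less
    note j = less.prems
    define u where "u = d ! (j - 1)"
    define T where "T = {i\<in>S. c ! (i - 1) < u}"
    define K where "K = {i\<in>?Dn. j < i}"
    define M where "M = rest c d S D j"
    have T_alt: "{i\<in>S. c ! (i - 1) \<le> u} = T"
      using ne[OF _ j] by (auto simp: T_def u_def order.order_iff_strict)
    have M: "M = int (card T) - int (card K)"
      unfolding M_def rest_def cnt_sel[OF fS] u_def[symmetric] T_alt K_def by simp
    have fT: "finite T" "finite K" using fS by (auto simp: T_def K_def)
    have K_le: "d ! (i - 1) \<le> u" if "i \<in> K" for i
      using that d_mono[of j i] by (auto simp: K_def u_def)
    have simps: "{i\<in>T. c ! (i - 1) < u} = T" "{i\<in>K. j < i} = K" by (auto simp: T_def K_def)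
    have jD: "j \<notin> D \<longleftrightarrow> proc a c d T K j" using proc[OF j] by (simp add: T_def K_def u_def)
    show ?case unfolding M_def[symmetric] u_def[symmetric]
    proof (cases "1 \<le> M")
      case False
      then have "\<not> proc a c d T K j"
        unfolding proc_def Let_def u_def[symmetric] simps using M by simp
      then show "j \<notin> D \<longleftrightarrow> 1 \<le> M \<and> (cnt a (u - 1) < M \<or>
        ar (sel c S) u - ar (sel d ?Dn) u \<le> tang a (nat (M - 1)) u)" using False jD by simp
    next
      case True
      then have "T \<noteq> {}" using M by auto
      define l where "l = (LEAST l. l \<in> T \<and> u > c ! (l - 1))"
      have l: "l \<in> T" "\<And>i. i \<in> T \<Longrightarrow> l \<le> i"
      proof -
        obtain i where "i \<in> T" using \<open>T \<noteq> {}\<close> by blast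
        then have "i \<in> T \<and> u > c ! (i - 1)" by (simp add: T_def)
        from LeastI[of "\<lambda>l. l \<in> T \<and> u > c ! (l - 1)", OF this] show "l \<in> T"
          by (simp add: l_def)
        show "l \<le> i" if "i \<in> T" for i
          unfolding l_def using that by (intro Least_le) (simp add: T_def)
      qed
      define x where "x = c ! (l - 1)"
      have xu: "x < u" using l(1) by (simp add: T_def x_def)
      have c_le: "c ! (i - 1) \<le> x" if "i \<in> T" for i
        using is_partition_nthD[OF part(2), of "l - 1" "i - 1"] l(2)[OF that] that S
        by (force simp: x_def T_def)
      have "{i\<in>T. l < i} = T - {l}" using l by force
      moreover have "0 < card T" using l(1) fT by (auto simp: card_gt_0_iff)
      ultimately have cT: "int (card {i\<in>T. l < i}) = int (card T) - 1"
        using l(1) fT by (simp add: of_nat_diff)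
      define k0 where "k0 = int (card {i\<in>K. d ! (i - 1) < x})"
      define N where "N = int (card {i\<in>{1..length a}. a ! (i - 1) > x}) - int (length a)
          + int (card {i\<in>T. l < i}) - k0 + 1"
      have N: "N = int (card T) - cnt a x - k0"
        unfolding N_def card_index_gt cT by simp
      have xd: "d ! (i - 1) \<noteq> x" if "i \<in> {1..length d}" for i
        using ne[of l i] l(1) that by (auto simp: x_def T_def)
      define B where "B = {i\<in>{1..length d}. j < i \<and> x < d ! (i - 1)}"
      have fB: "finite B" by (simp add: B_def)
      have "K = {i\<in>K. d ! (i - 1) < x} \<union> (K \<inter> B)"
        using xd by (auto simp: K_def B_def neq_iff)
      then have "card K = card ({i\<in>K. d ! (i - 1) < x} \<union> (K \<inter> B))" by simp
      also have "\<dots> = card {i\<in>K. d ! (i - 1) < x} + card (K \<inter> B)"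
        using fT by (intro card_Un_disjoint) (auto simp: B_def)
      finally have cK: "int (card K) = k0 + int (card (K \<inter> B))" by (simp add: k0_def)
      have forced: "N \<ge> 1 \<and> among_smallest d a j N x \<longleftrightarrow>
          cnt a (u - 1) < int (card T) - k0 - int (card B)"
      proof -
        have "cnt a x \<le> cnt a (u - 1)" using xu by (intro cnt_mono) simp
        then show ?thesis
          using among_smallest_iff[OF part(3) j xu[unfolded u_def], of a N]
            card_index_gt_above[OF part(3) j xu[unfolded u_def]] N
          by (auto simp: B_def u_def)
      qed
      have forced_iff: "N \<ge> 1 \<and> among_smallest d a j N x \<longleftrightarrow> cnt a (u - 1) < M"
      proof
        assume "N \<ge> 1 \<and> among_smallest d a j N x"
        moreover have "card (K \<inter> B) \<le> card B" using fB by (intro card_mono) auto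
        ultimately show "cnt a (u - 1) < M" using forced M cK by linarith
      next
        assume less_M: "cnt a (u - 1) < M"
        have "B \<subseteq> K"
        proof
          fix i assume i: "i \<in> B"
          then have iB: "i \<in> {1..length d}" "j < i" "x < d ! (i - 1)" by (auto simp: B_def)
          have du: "d ! (i - 1) \<le> u" using d_mono[of j i] iB by (simp add: u_def)
          \<comment> \<open>\<open>x\<close> is the largest value in \<open>T\<close>, so passing
            from \<open>u\<close> down to an entry above \<open>x\<close> loses no selected
            \<open>c\<close>; hence \<open>rest\<close> at \<open>i\<close> is at least
            \<open>M\<close> and the induction hypothesis applies.\<close>
          have "{t\<in>S. c ! (t - 1) \<le> d ! (i - 1)} = T"
          proof (intro set_eqI iffI)
            fix t assume "t \<in> T" then show "t \<in> {t\<in>S. c ! (t - 1) \<le> d ! (i - 1)}"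
              using c_le[of t] iB(3) by (auto simp: T_def)
          next
            fix t assume "t \<in> {t\<in>S. c ! (t - 1) \<le> d ! (i - 1)}"
            then have "t \<in> {i\<in>S. c ! (i - 1) \<le> u}" using du by auto
            then show "t \<in> T" unfolding T_alt .
          qed
          moreover have "card {t\<in>?Dn. i < t} \<le> card K"
            using iB(2) unfolding K_def by (intro card_mono) auto
          ultimately have "M \<le> rest c d S D i"
            using fS M by (simp add: rest_def cnt_sel)
          moreover have "cnt a (d ! (i - 1) - 1) \<le> cnt a (u - 1)" using du by (intro cnt_mono) simp
          ultimately have "i \<notin> D"
            using less.hyps[of i] iB True less_M by auto
          then show "i \<in> K" using iB by (simp add: K_def)
        qed
        then have "K \<inter> B = B" by blast
        then show "N \<ge> 1 \<and> among_smallest d a j N x" using forced less_M M cK by simp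
      qed
      have proc_iff: "proc a c d T K j \<longleftrightarrow> (N \<ge> 1 \<and> among_smallest d a j N x) \<or>
          ereal (\<Sum>i\<in>T. c ! (i - 1)) \<ge> ereal (\<Sum>i\<in>K. d ! (i - 1)) + ereal u
            + sumE a (int (length a) - M + 1 + 1) (int (length a))"
      proof -
        have q: "int (length a) - int (card T) + int (card K) + 1 = int (length a) - M + 1"
          using M by simp
        show ?thesis
          unfolding proc_def Let_def u_def[symmetric] simps q l_def[symmetric] x_def[symmetric]
            k0_def[symmetric] N_def[symmetric]
          using True by simp blast
      qed
      have bal: "ereal (\<Sum>i\<in>T. c ! (i - 1)) \<ge> ereal (\<Sum>i\<in>K. d ! (i - 1)) + ereal u
            + sumE a (int (length a) - M + 1 + 1) (int (length a))
          \<longleftrightarrow> ar (sel c S) u - ar (sel d ?Dn) u \<le> tang a (nat (M - 1)) u"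
        if "M \<le> cnt a (u - 1)"
      proof -
        \<comment> \<open>Since \<open>q\<close> is \<open>length a - M + 1\<close>, the sum from
          \<open>q + 1\<close> runs over the \<open>M - 1\<close> smallest entries of
          \<open>a\<close>, exactly those subtracted by the tangent of slope
          \<open>M - 1\<close>.\<close>
        define k where "k = nat (M - 1)"
        have k: "int k = M - 1" "k \<le> length a"
          using True that cnt_le_length[of a "u - 1"] by (auto simp: k_def)
        have idx: "int (length a) - M + 1 + 1 = int (length a - k) + 1" using k by simp
        have sE: "sumE a (int (length a) - M + 1 + 1) (int (length a))
            = ereal (sum_list (drop (length a - k) a))"
          unfolding idx using sumE_eq[of "length a - k" "length a" a] by simp
        have aT: "ar (sel c S) u = int (card T) * u - (\<Sum>i\<in>T. c ! (i - 1))"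
          using fS by (intro ar_sel_subset) (auto simp: T_def)
        have aK: "ar (sel d ?Dn) u = int (card K) * u - (\<Sum>i\<in>K. d ! (i - 1))"
        proof (rule ar_sel_subset)
          show "u \<le> d ! (i - 1)" if "i \<in> ?Dn - K" for i
            using that j d_mono[of i j] by (auto simp: K_def u_def)
        qed (use K_le in \<open>auto simp: K_def\<close>)
        have "ar (sel c S) u - ar (sel d ?Dn) u = int k * u + u - (\<Sum>i\<in>T. c ! (i - 1)) + (\<Sum>i\<in>K. d ! (i - 1))"
        proof -
          have "int (card T) = int k + 1 + int (card K)" using k(1) M by simp
          then show ?thesis unfolding aT aK by (simp add: algebra_simps)
        qed
        moreover have sums: "ereal (real_of_int p) + ereal (real_of_int q) + ereal (real_of_int r)
            \<le> ereal (real_of_int v) \<longleftrightarrow> p + q + r \<le> v" for p q r v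
          by (simp flip: of_int_add)
        ultimately show ?thesis
          unfolding sE k_def[symmetric] tang_def of_int_sum[symmetric] sums by linarith
      qed
      show "j \<notin> D \<longleftrightarrow> 1 \<le> M \<and> (cnt a (u - 1) < M \<or>
        ar (sel c S) u - ar (sel d ?Dn) u \<le> tang a (nat (M - 1)) u)"
        unfolding jD proc_iff forced_iff
      proof (cases "cnt a (u - 1) < M")
        case False
        then have "M \<le> cnt a (u - 1)" by simp
        then show "(cnt a (u - 1) < M \<or>
            ereal (\<Sum>i\<in>T. c ! (i - 1)) \<ge> ereal (\<Sum>i\<in>K. d ! (i - 1)) + ereal u
              + sumE a (int (length a) - M + 1 + 1) (int (length a)))
          \<longleftrightarrow> 1 \<le> M \<and> (cnt a (u - 1) < M \<or>
            ar (sel c S) u - ar (sel d ?Dn) u \<le> tang a (nat (M - 1)) u)"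
          unfolding bal[OF \<open>M \<le> cnt a (u - 1)\<close>] using True by blast
      qed (use True in blast)
    qed
  qed
qed

text \<open>Membership never changes once decided, so the state seen by an element is the part of
  the final sets with smaller key. The fold thus becomes a recursion stated for the final sets
  alone.\<close>

lemma fold_step_spec:
  fixes key :: "nat + nat \<Rightarrow> 'k :: linorder"
  assumes "sorted_wrt (\<lambda>x y. key x < key y) P"
    and "fold (step a b c d) P ({}, {}, {}, {}) = (S, Sn, D, Dn)"
  shows "S \<inter> Sn = {} \<and> S \<union> Sn = {j. Inl j \<in> set P} \<and> D \<inter> Dn = {} \<and> D \<union> Dn = {j. Inr j \<in> set P} \<and>
    (\<forall>j. Inr j \<in> set P \<longrightarrow> (j \<in> Dn \<longleftrightarrow> proc a c d {i\<in>S. key (Inl i) < key (Inr j)}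
        {i\<in>Dn. key (Inr i) < key (Inr j)} j)) \<and>
    (\<forall>j. Inl j \<in> set P \<longrightarrow> (j \<in> Sn \<longleftrightarrow> proc b d c {i\<in>D. key (Inr i) < key (Inl j)}
        {i\<in>Sn. key (Inl i) < key (Inl j)} j))"
  using assms
proof (induction P arbitrary: S Sn D Dn rule: rev_induct)
  case Nil then show ?case by simp
next
  case (snoc x P)
  obtain S0 Sn0 D0 Dn0 where st: "fold (step a b c d) P ({}, {}, {}, {}) = (S0, Sn0, D0, Dn0)"
    by (metis prod.exhaust)
  have sorted: "sorted_wrt (\<lambda>x y. key x < key y) P" and last: "\<And>y. y \<in> set P \<Longrightarrow> key y < key x"
    using snoc.prems(1) by (auto simp: sorted_wrt_append)
  note IH = snoc.IH[OF sorted st]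
  have step: "step a b c d x (S0, Sn0, D0, Dn0) = (S, Sn, D, Dn)"
    using snoc.prems(2) st by simp
  have xP: "x \<notin> set P" using last by blast
  have S0: "key (Inl i) < key x" if "i \<in> S0 \<union> Sn0" for i using IH last that by blast
  have D0: "key (Inr i) < key x" if "i \<in> D0 \<union> Dn0" for i using IH last that by blast
  show ?case
  proof (cases x)
    case (Inl j)
    have new: "{i\<in>D0. key (Inr i) < key (Inl j)} = D0" "{i\<in>Sn0. key (Inl i) < key (Inl j)} = Sn0"
      "{i. (i = j \<or> i \<in> Sn0) \<and> key (Inl i) < key (Inl j)} = Sn0"
      using S0 D0 Inl by auto
    have old: "{i\<in>insert j X. key (Inl i) < key y} = {i\<in>X. key (Inl i) < key y}" if "y \<in> set P" for X y
      using last[OF that] Inl by auto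
    have j: "j \<notin> S0" "j \<notin> Sn0" using IH xP Inl by auto
    show ?thesis
    proof (cases "proc b d c D0 Sn0 j")
      case True
      then have eq: "S = S0" "Sn = insert j Sn0" "D = D0" "Dn = Dn0" using step Inl by auto
      show ?thesis unfolding eq using IH Inl new old j True last[of "Inl j"] by auto
    next
      case False
      then have eq: "S = insert j S0" "Sn = Sn0" "D = D0" "Dn = Dn0" using step Inl by auto
      show ?thesis unfolding eq using IH Inl new old j False by auto
    qed
  next
    case (Inr j)
    have new: "{i\<in>S0. key (Inl i) < key (Inr j)} = S0" "{i\<in>Dn0. key (Inr i) < key (Inr j)} = Dn0"
      "{i. (i = j \<or> i \<in> Dn0) \<and> key (Inr i) < key (Inr j)} = Dn0"
      using S0 D0 Inr by auto
    have old: "{i\<in>insert j X. key (Inr i) < key y} = {i\<in>X. key (Inr i) < key y}" if "y \<in> set P" for X y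
      using last[OF that] Inr by auto
    have j: "j \<notin> D0" "j \<notin> Dn0" using IH xP Inr by auto
    show ?thesis
    proof (cases "proc a c d S0 Dn0 j")
      case True
      then have eq: "S = S0" "Sn = Sn0" "D = D0" "Dn = insert j Dn0" using step Inr by auto
      show ?thesis unfolding eq using IH Inr new old j True by auto
    next
      case False
      then have eq: "S = S0" "Sn = Sn0" "D = insert j D0" "Dn = Dn0" using step Inr by auto
      show ?thesis unfolding eq using IH Inr new old j False by auto
    qed
  qed
qed

lemma construct_spec:
  fixes a b c d
  defines "S \<equiv> Sset a b c d" and "D \<equiv> Delta a b c d"
  assumes part: "is_partition c" "is_partition d" and disj: "\<forall>x\<in>set c. \<forall>y\<in>set d. x \<noteq> y"
  shows "S \<subseteq> {1..length c}" "D \<subseteq> {1..length d}"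
    and "\<And>j. j \<in> {1..length d} \<Longrightarrow> j \<notin> D \<longleftrightarrow>
      proc a c d {i\<in>S. c ! (i - 1) < d ! (j - 1)} {i\<in>compl_in d D. j < i} j"
    and "\<And>j. j \<in> {1..length c} \<Longrightarrow> j \<notin> S \<longleftrightarrow>
      proc b d c {i\<in>D. d ! (i - 1) < c ! (j - 1)} {i\<in>compl_in c S. j < i} j"
proof -
  define key :: "nat + nat \<Rightarrow> int \<times> int" where
    "key = (\<lambda>x. case x of Inl j \<Rightarrow> (c ! (j - 1), - int j) | Inr j \<Rightarrow> (d ! (j - 1), - int j))"
  define L :: "(nat + nat) list" where "L = map Inl [1..<Suc (length c)] @ map Inr [1..<Suc (length d)]"
  have P: "proc_order c d = sort_key key L" by (simp add: proc_order_def key_def L_def)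
  have mem: "Inl j \<in> set L \<longleftrightarrow> j \<in> {1..length c}" "Inr j \<in> set L \<longleftrightarrow> j \<in> {1..length d}" for j
    by (auto simp: L_def)
  have ne: "c ! (i - 1) \<noteq> d ! (j - 1)" if "i \<in> {1..length c}" "j \<in> {1..length d}" for i j
  proof -
    have "i - 1 < length c" "j - 1 < length d" using that by auto
    then show ?thesis using disj by auto
  qed
  \<comment> \<open>Keys of different kinds differ because no \<open>c\<close> equals a
    \<open>d\<close>; within one kind the negated index separates ties. Hence the processing order
    is strict.\<close>
  have "inj_on key (set L)"
  proof (rule inj_onI)
    fix x y assume "x \<in> set L" "y \<in> set L" "key x = key y"
    then show "x = y" using ne not_sym[OF ne] by - (cases x; cases y; auto simp: key_def mem simp del: One_nat_def)
  qed
  moreover have "distinct L" by (auto simp: L_def distinct_map simp del: upt_Suc)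
  ultimately have "distinct (map key (sort_key key L))" by (simp add: distinct_map)
  moreover have "sorted (map key (sort_key key L))" by simp
  ultimately have "sorted_wrt (<) (map key (sort_key key L))" by (simp add: strict_sorted_iff)
  then have sorted: "sorted_wrt (\<lambda>x y. key x < key y) (proc_order c d)"
    by (simp add: P sorted_wrt_map)
  obtain S' Sn D' Dn where st: "construct a b c d = (S', Sn, D', Dn)" by (metis prod.exhaust)
  have eq: "S' = S" "D' = D" using st by (simp_all add: S_def D_def Sset_def Delta_def)
  note spec = fold_step_spec[OF sorted st[unfolded construct_def eq]]
  have Sn: "S \<subseteq> {1..length c}" "Sn = compl_in c S" and Dn: "D \<subseteq> {1..length d}" "Dn = compl_in d D"
    using spec by (auto simp: P mem)
  show "S \<subseteq> {1..length c}" "D \<subseteq> {1..length d}" by (fact Sn Dn)+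
  have mono: "key' i < key' j \<longleftrightarrow> j < i"
    if "is_partition xs" "i \<in> {1..length xs}" "j \<in> {1..length xs}" "key' = (\<lambda>j. (xs ! (j - 1), - int j))"
    for xs :: "int list" and key' i j
    using is_partition_index_mono[OF that(1) _ that(2), of j]
      is_partition_index_mono[OF that(1) _ that(3), of i] that(4) by (cases i j rule: linorder_cases) (auto simp: less_prod_simp)
  show "j \<notin> D \<longleftrightarrow>
      proc a c d {i\<in>S. c ! (i - 1) < d ! (j - 1)} {i\<in>compl_in d D. j < i} j" if j: "j \<in> {1..length d}" for j
  proof -
    have "{i\<in>S. key (Inl i) < key (Inr j)} = {i\<in>S. c ! (i - 1) < d ! (j - 1)}"
      using ne[OF subsetD[OF Sn(1)] j]
      by (auto simp: key_def less_prod_simp order.order_iff_strict simp del: One_nat_def)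
    moreover have "{i\<in>Dn. key (Inr i) < key (Inr j)} = {i\<in>compl_in d D. j < i}"
      using mono[OF part(2) _ j] Dn(2) by (intro Collect_cong) (auto simp: key_def)
    ultimately show ?thesis using spec j Dn(2) by (auto simp: P mem)
  qed
  show "j \<notin> S \<longleftrightarrow>
      proc b d c {i\<in>D. d ! (i - 1) < c ! (j - 1)} {i\<in>compl_in c S. j < i} j" if j: "j \<in> {1..length c}" for j
  proof -
    have "{i\<in>D. key (Inr i) < key (Inl j)} = {i\<in>D. d ! (i - 1) < c ! (j - 1)}"
      using not_sym[OF ne[OF j subsetD[OF Dn(1)]]]
      by (auto simp: key_def less_prod_simp order.order_iff_strict simp del: One_nat_def)
    moreover have "{i\<in>Sn. key (Inl i) < key (Inl j)} = {i\<in>compl_in c S. j < i}"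
      using mono[OF part(1) _ j] Sn(2) by (intro Collect_cong) (auto simp: key_def)
    ultimately show ?thesis using spec j Sn(2) by (auto simp: P mem)
  qed
qed

theorem theorem4p2:
  fixes a b c d :: "int list"
  assumes "length d > 0" and "length c > 0" and "length a > 0" and "length b > 0"
    and "length d + length a = length c + length b"
    and "is_partition a" and "is_partition b" and "is_partition c" and "is_partition d"
    and "\<forall>x\<in>set c. \<forall>y\<in>set d. x \<noteq> y"
  shows "(\<exists>g. length g = length d + length a \<and> is_partition g \<and> gmaj g d a \<and> gmaj g c b)
         \<longleftrightarrow> (sum_list c + sum_list b = sum_list d + sum_list a
              \<and> cond_i a c d (Sset a b c d) (Delta a b c d)
              \<and> cond_i b d c (Delta a b c d) (Sset a b c d))"
proof -
  define S where "S = Sset a b c d"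
  define D where "D = Delta a b c d"
  note part = assms(6-9) and len = assms(5) and disj = assms(10)
  have disj': "\<forall>x\<in>set d. \<forall>y\<in>set c. x \<noteq> y" using disj by blast
  note spec = construct_spec[OF part(3,4) disj, where a = a and b = b, folded S_def D_def]
  note S = spec(1) and D = spec(2)
  have greedy: "greedy a c d S D" by (rule greedyI[OF part(1,3,4) S D disj spec(3)])
  have greedy': "greedy b d c D S" by (rule greedyI[OF part(2,4,3) D S disj' spec(4)])
  define X where "X = sel c S @ sel d D"
  have X_swap: "cnt (sel d D @ sel c S) = cnt X" "ar (sel d D @ sel c S) = ar X"
    by (auto simp: X_def)
  have conds: "cond_i a c d S D \<longleftrightarrow> (\<forall>u. ar X u \<le> ar d u + ar a u)"
    "cond_i b d c D S \<longleftrightarrow> (\<forall>u. ar X u \<le> ar c u + ar b u)"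
    using cond_i_iff[OF part(1,3,4) S D disj greedy] cond_i_iff[OF part(2,4,3) D S disj' greedy']
    by (simp_all add: X_def X_swap)
  have "(\<exists>g. length g = length d + length a \<and> is_partition g \<and> gmaj g d a \<and> gmaj g c b)
      \<longleftrightarrow> (sum_list c + sum_list b = sum_list d + sum_list a
        \<and> (\<forall>u. ar X u \<le> ar d u + ar a u) \<and> (\<forall>u. ar X u \<le> ar c u + ar b u))" (is "_ \<longleftrightarrow> ?R")
  proof
    assume "\<exists>g. length g = length d + length a \<and> is_partition g \<and> gmaj g d a \<and> gmaj g c b"
    then obtain g where g: "length g = length d + length a" "is_partition g" "gmaj g d a" "gmaj g c b"
      by blast
    have gl: "length g = length c + length b" using g(1) len by simp
    have "ar X u \<le> ar g u" for u
      unfolding X_def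
      by (intro ar_mono greedy_minimal[OF part S D disj greedy greedy' g(2,1) gl g(3,4)])
    moreover have "ar g u \<le> ar d u + ar a u" for u
      by (rule gmaj_area_le[OF g(2) part(4) g(1,3)])
    moreover have "ar g u \<le> ar c u + ar b u" for u
      by (rule gmaj_area_le[OF g(2) part(3) gl g(4)])
    moreover have "sum_list c + sum_list b = sum_list d + sum_list a"
      using g(3,4) by (simp add: gmaj_def)
    ultimately show ?R by (meson order_trans)
  next
    assume R: ?R
    define t where "t = sum_list d + sum_list a"
    obtain U where "\<And>x. x \<in> set (X @ d @ a) \<Longrightarrow> x \<le> U" using set_upper_bound[of 0] by blast
    then have U: "\<And>x. x \<in> set X \<Longrightarrow> x \<le> U" "\<And>x. x \<in> set d \<Longrightarrow> x \<le> U" "\<And>x. x \<in> set a \<Longrightarrow> x \<le> U"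
      by auto
    \<comment> \<open>Beyond all entries the area is linear with the total sum as its constant, so
      the area inequality at \<open>U\<close> is the hypothesis of
      \<open>truncation\<close>.\<close>
    have arU: "ar d v + ar a v = int (length d + length a) * v - t" if "U \<le> v" for v
      using ar_all[of d v] ar_all[of a v] U that by (force simp: t_def algebra_simps)
    have "length X \<le> length d + length a"
      using area_le_imp_length_le[of X "d @ a"] R by simp
    moreover have "ar X U \<le> ar d U + ar a U" using R by blast
    then have "ar X U \<le> int (length d + length a) * U - t" using arU[of U] by simp
    ultimately obtain g T where g: "length g = length d + length a" "is_partition g" "sum_list g = t"
      "\<And>u. u < T \<Longrightarrow> cnt g u = cnt X u" "cnt X T \<le> cnt g T"
      "\<And>u. T < u \<Longrightarrow> cnt g u = int (length d + length a)"
      using truncation[of "length d + length a" X U t] assms(1) U(1) by (metis add_gr_0)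
    have gl: "length g = length c + length b" using g(1) len by simp
    have totals: "sum_list g = sum_list d + sum_list a" "sum_list g = sum_list c + sum_list b"
      using g(3) R by (simp_all add: t_def)
    have areas: "ar X u \<le> ar d u + ar a u" "ar X u \<le> ar c u + ar b u" for u using R by blast+
    note greedy_ad = greedy_dominates[OF part(1,3,4) S D disj greedy, folded X_def]
      greedy_descent[OF part(1,3,4) S D disj greedy, folded X_def]
    note greedy_bc = greedy_dominates[OF part(2,4,3) D S disj' greedy', unfolded X_swap]
      greedy_descent[OF part(2,4,3) D S disj' greedy', unfolded X_swap]
    have "gmaj g d a"
      by (rule gmaj_truncation[OF g(2) part(4,1) g(1) totals(1) greedy_ad(1) areas(1) greedy_ad(2)
            g(4-6)])
    moreover have "gmaj g c b"
      by (rule gmaj_truncation[OF g(2) part(3,2) gl totals(2) greedy_bc(1) areas(2) greedy_bc(2)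
            g(4,5) g(6)[unfolded len]])
    ultimately show "\<exists>g. length g = length d + length a \<and> is_partition g \<and> gmaj g d a \<and> gmaj g c b"
      using g(1,2) by blast
  qed
  then show ?thesis unfolding conds[symmetric] S_def D_def .
qed

end
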